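(* Let $G$ be a finite graph embedded in $\mathbb R^2$ with straight-line edges, with edge weights $K_{xy}$, and let $C_1,\dots,C_m$ be pairwise edge-disjoint loops in $G$. Then \[ \prod_j(-1)^{\mathrm{si}(C_j)}\prod_{j<k}(-1)^{\mathrm{mi}(C_j,C_k)}\prod_{xy\in\bigcup_jE(C_j)}K_{xy}=\prod_j\Big((-1)^{\tau(C_j)+1}\prod_{xy\in E(C_j)}K_{xy}\Big). \]
   Context: A loop is an equivalence class of closed walks $(\gamma_1,\dots,\gamma_k,\gamma_{k+1}=\gamma_1)$ that are edge-simple (no edge traversed twice), modulo cyclic shifts and reversal. Each passage of a loop through a vertex $v$ uses an unordered pair of edges at $v$ (a transition). Two transitions $\{e_1,e_2\},\{h_1,h_2\}$ at $v$ cross if $e_1<h_1<e_2<h_2$ in the counterclockwise cyclic order of edges around $v$. $\mathrm{si}(C)$ is the number of crossing pairs of transitions both belonging to $C$ (over all vertices); $\mathrm{mi}(C,C')$ is the number of crossing pairs with one transition from $C$ and one from $C'$. The turning number of a loop is $\tau(C)=\frac1{2\pi}\sum_{j=1}^k\theta_j \bmod 2$, where $\theta_j$ is the exterior (turning) angle of the polygonal path at $\gamma_{j+1}$ between segments $\gamma_j\gamma_{j+1}$ and $\gamma_{j+1}\gamma_{j+2}$. *)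

theory Defs
  imports "HOL-Analysis.Analysis"
begin

definition straight_line_plane_graph :: "complex set \<Rightarrow> complex set set \<Rightarrow> bool" where
  "straight_line_plane_graph V E \<longleftrightarrow>
     finite V \<and>
     E \<subseteq> {{a, b} | a b. a \<in> V \<and> b \<in> V \<and> a \<noteq> b} \<and>
     (\<forall>a b. {a, b} \<in> E \<longrightarrow> closed_segment a b \<inter> V = {a, b}) \<and>
     (\<forall>a b c d. {a, b} \<in> E \<longrightarrow> {c, d} \<in> E \<longrightarrow> {a, b} \<noteq> {c, d} \<longrightarrow>
        closed_segment a b \<inter> closed_segment c d \<subseteq> {a, b} \<inter> {c, d})"

text \<open>A loop is represented by a closed walk \<open>[\<gamma>_1,...,\<gamma>_k]\<close> (with \<open>\<gamma>_{k+1} = \<gamma>_1\<close>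
  implicit); indices are taken modulo k.\<close>

definition walk_vtx :: "complex list \<Rightarrow> nat \<Rightarrow> complex" where
  "walk_vtx ws i = ws ! (i mod length ws)"

definition walk_edge :: "complex list \<Rightarrow> nat \<Rightarrow> complex set" where
  "walk_edge ws j = {walk_vtx ws j, walk_vtx ws (Suc j)}"

definition loop_edges :: "complex list \<Rightarrow> complex set set" where
  "loop_edges ws = walk_edge ws ` {..<length ws}"

definition is_loop :: "complex set set \<Rightarrow> complex list \<Rightarrow> bool" where
  "is_loop E ws \<longleftrightarrow> ws \<noteq> [] \<and>
     (\<forall>j < length ws. walk_edge ws j \<in> E) \<and>
     inj_on (walk_edge ws) {..<length ws}"

text \<open>Transition used at vertex \<open>\<gamma>_{j+1}\<close>: the vertex together with the unordered pair of
  edges, each edge at the vertex being identified by its other endpoint.\<close>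

definition transitions :: "complex list \<Rightarrow> (complex \<times> complex set) set" where
  "transitions ws = (\<lambda>j. (walk_vtx ws (Suc j), {walk_vtx ws j, walk_vtx ws (Suc (Suc j))}))
                      ` {..<length ws}"

definition ccw_angle :: "complex \<Rightarrow> complex \<Rightarrow> complex \<Rightarrow> real" where
  "ccw_angle v x0 x = Arg2pi ((x - v) / (x0 - v))"

text \<open>Transitions \<open>{e1,e2}\<close>, \<open>{h1,h2}\<close> at \<open>v\<close> cross iff \<open>e1 < h1 < e2 < h2\<close> in the
  counterclockwise cyclic order of edges around \<open>v\<close> (for some labelling).\<close>

definition transitions_cross :: "complex \<times> complex set \<Rightarrow> complex \<times> complex set \<Rightarrow> bool" where
  "transitions_cross t s \<longleftrightarrow> fst t = fst s \<and>
     (\<exists>e1 e2 h1 h2. snd t = {e1, e2} \<and> snd s = {h1, h2} \<and>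
        0 < ccw_angle (fst t) e1 h1 \<and>
        ccw_angle (fst t) e1 h1 < ccw_angle (fst t) e1 e2 \<and>
        ccw_angle (fst t) e1 e2 < ccw_angle (fst t) e1 h2)"

definition si :: "complex list \<Rightarrow> nat" where
  "si ws = card {{t, s} | t s. t \<in> transitions ws \<and> s \<in> transitions ws \<and> t \<noteq> s \<and>
                               transitions_cross t s}"

definition mi :: "complex list \<Rightarrow> complex list \<Rightarrow> nat" where
  "mi ws ws' = card {(t, s). t \<in> transitions ws \<and> s \<in> transitions ws' \<and> transitions_cross t s}"

definition turning_angle :: "complex list \<Rightarrow> nat \<Rightarrow> real" where
  "turning_angle ws j =
     Arg ((walk_vtx ws (Suc (Suc j)) - walk_vtx ws (Suc j)) / (walk_vtx ws (Suc j) - walk_vtx ws j))"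

text \<open>The total turning divided by \<open>2\<pi>\<close> (an integer for a closed polygon), and \<open>\<tau>\<close> = it mod 2.\<close>

definition total_turning :: "complex list \<Rightarrow> real" where
  "total_turning ws = (\<Sum>j<length ws. turning_angle ws j) / (2 * pi)"

definition tau :: "complex list \<Rightarrow> nat" where
  "tau ws = nat ((THE n::int. total_turning ws = of_int n) mod 2)"

end

(*
  Sweep a generic line over the plane. For two distinct edges e, h of a plane graph, the heights at
  which both are present form an interval on which "e is left of h" is constant, so modulo 2 the
  start and the end of that interval cancel. Sum this over pairs of edges and regroup by vertices.
  An end of one edge inside the height range of another edge contributes nothing in total, because a
  closed trail has even degree everywhere. What remains are pairs of edges meeting at a vertex v,
  and there a pair of transitions contributes exactly its crossing parity. For two edge-disjoint
  trails this makes mi even. For a single trail, taken in the order of traversal from its highest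
  vertex, the two edges of one transition also form a pair; it counts iff the turn sweeps over the
  positive horizontal direction, and these turns add up to the turning number modulo 2. Closing the
  trail reverses one comparison at the highest vertex, which yields the extra 1.
*)

theory Submission
  imports Defs "HOL-Library.Z2"
begin

section \<open>Sums over closed index ranges\<close>

(* These rules turn ring operations on bit into XOR and AND, out of reach of the ring simp rules. *)
declare add_bit_eq_xor [simp del] mult_bit_eq_and [simp del]

lemma periodic_mod:
  fixes f :: "nat \<Rightarrow> 'a"
  assumes "\<And>i. f (i + k) = f i"
  shows "f (i mod k) = f i"
proof -
  have "f (i + n * k) = f i" for i n
    by (induction n arbitrary: i) (simp_all add: assms flip: add.assoc)
  from this[of "i mod k" "i div k"] show ?thesis by simp
qed

lemma periodic_image:
  fixes f :: "nat \<Rightarrow> 'a"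
  assumes per: "\<And>i. f (i + k) = f i" and "k > 0"
  shows "(\<lambda>i. f (i + m)) ` {..<k} = f ` {..<k}"
proof -
  have *: "g ` {..<k} = range g" if "\<And>i. g (i + k) = g i" for g :: "nat \<Rightarrow> 'a"
    using periodic_mod[of g, OF that] \<open>k > 0\<close>
    by (auto simp: image_iff) (metis lessThan_iff mod_less_divisor)
  have "f i \<in> range (\<lambda>i. f (i + m))" for i
  proof -
    \<comment> \<open>Adding \<open>m * (k - 1)\<close> stands in for subtracting \<open>m\<close>,
      which could be truncated on natural numbers.\<close>
    have "f ((i + m * (k - 1)) + m) = f (i + m * k)"
      using \<open>k > 0\<close> by (cases k) (simp_all add: algebra_simps)
    also have "\<dots> = f i"
      using periodic_mod[of f k "i + m * k", OF per] periodic_mod[of f k i, OF per] by simp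
    finally show ?thesis by (metis rangeI)
  qed
  then have "range (\<lambda>i. f (i + m)) = range f" by auto
  moreover have "(\<lambda>i. f (i + m)) ` {..<k} = range (\<lambda>i. f (i + m))"
    by (rule *) (metis add.assoc add.commute per)
  ultimately show ?thesis using *[of f] per by simp
qed

lemma sum_periodic_Suc:
  fixes f :: "nat \<Rightarrow> 'a::comm_monoid_add"
  assumes "f k = f 0"
  shows "(\<Sum>i<k. f (Suc i)) = (\<Sum>i<k. f i)"
proof (cases k)
  case (Suc n)
  then show ?thesis
    using assms sum.lessThan_Suc_shift[of f n] by (simp add: add.commute)
qed simp

lemma sum_periodic_shift:
  fixes f :: "nat \<Rightarrow> 'a::comm_monoid_add"
  assumes "\<And>i. f (i + k) = f i"
  shows "(\<Sum>i<k. f (i + m)) = (\<Sum>i<k. f i)"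
proof (induction m)
  case (Suc m)
  have "f (k + m) = f (0 + m)" using assms[of m] by (simp add: add.commute)
  from sum_periodic_Suc[of "\<lambda>i. f (i + m)", OF this] show ?case
    using Suc by simp
qed simp

text \<open>Summation by parts on a cycle. With \<open>a i\<close> indicating that a trail is at a
  given vertex at time \<open>i\<close>, a sum over the edges at that vertex becomes a sum over the
  passages through it.\<close>

lemma sum_edges_eq_sum_transitions:
  fixes a F :: "nat \<Rightarrow> 'a::comm_semiring_1"
  assumes "a k = a 0" "F k = F 0"
  shows "(\<Sum>i<k. (a i + a (Suc i)) * F i) = (\<Sum>i<k. a (Suc i) * (F i + F (Suc i)))"
  using sum_periodic_Suc[of "\<lambda>i. a i * F i" k] assms
  by (simp add: algebra_simps sum.distrib)

lemma symmetric_double_sum: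
  fixes f :: "nat \<Rightarrow> nat \<Rightarrow> 'a::comm_semiring_1"
  assumes "\<And>i j. f i j = f j i"
  shows "(\<Sum>i<k. \<Sum>j<k. f i j) = 2 * (\<Sum>j<k. \<Sum>i<j. f i j) + (\<Sum>i<k. f i i)"
proof (induction k)
  case (Suc k)
  have "(\<Sum>j<k. f k j) = (\<Sum>i<k. f i k)" by (simp add: assms[of k])
  with Suc show ?case by (simp add: sum.distrib algebra_simps mult_2)
qed simp

text \<open>The version for pairs \<open>i < j\<close>, obtained by halving a sum over the full
  square. Halving is impossible modulo 2, hence the type \<open>int\<close>. The last sum comes from
  the two edges of a single transition, which also form a pair.\<close>

lemma pair_sum_edges_eq_transitions:
  fixes a :: "nat \<Rightarrow> int" and S :: "nat \<Rightarrow> nat \<Rightarrow> int"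
  assumes a: "a k = a 0" and S: "\<And>i. S i k = S i 0" and sym: "\<And>i j. S i j = S j i"
    and diag: "\<And>i. S i i = 0"
  shows "(\<Sum>j<k. \<Sum>i<j. (a i + a (Suc i)) * (a j + a (Suc j)) * S i j)
       = (\<Sum>j<k. \<Sum>i<j. a (Suc i) * a (Suc j) *
            (S i j + S i (Suc j) + S (Suc i) j + S (Suc i) (Suc j)))
         + (\<Sum>i<k. a (Suc i) ^ 2 * S i (Suc i))"
    (is "?L = ?R + ?D")
proof -
  let ?f = "\<lambda>i j. (a i + a (Suc i)) * (a j + a (Suc j)) * S i j"
  let ?g = "\<lambda>i j. a (Suc i) * a (Suc j) *
            (S i j + S i (Suc j) + S (Suc i) j + S (Suc i) (Suc j))"
  have S': "S k i = S 0 i" for i using S sym by metis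
  have "2 * ?L = (\<Sum>i<k. \<Sum>j<k. ?f i j)"
  proof -
    have "?f i j = ?f j i" for i j using sym[of i j] by simp
    from symmetric_double_sum[of ?f, OF this] show ?thesis by (simp add: diag)
  qed
  also have "\<dots> = (\<Sum>i<k. (a i + a (Suc i)) * (\<Sum>j<k. (a j + a (Suc j)) * S i j))"
    by (simp add: sum_distrib_left mult.assoc)
  also have "\<dots> = (\<Sum>i<k. (a i + a (Suc i)) * (\<Sum>j<k. a (Suc j) * (S i j + S i (Suc j))))"
    using sum_edges_eq_sum_transitions[of a k "S i" for i, OF a S] by simp
  also have "\<dots> = (\<Sum>i<k. a (Suc i) * ((\<Sum>j<k. a (Suc j) * (S i j + S i (Suc j)))
                      + (\<Sum>j<k. a (Suc j) * (S (Suc i) j + S (Suc i) (Suc j)))))"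
    by (subst sum_edges_eq_sum_transitions[OF a]) (simp_all add: S')
  also have "\<dots> = (\<Sum>i<k. \<Sum>j<k. ?g i j)"
    by (simp add: sum_distrib_left algebra_simps sum.distrib)
  also have "\<dots> = 2 * ?R + (\<Sum>i<k. ?g i i)"
    by (rule symmetric_double_sum) (simp add: sym algebra_simps)
  \<comment> \<open>On the diagonal the two mixed values of \<open>S\<close> agree by symmetry and
    the other two vanish, so this part is even as well.\<close>
  also have "(\<Sum>i<k. ?g i i) = 2 * ?D"
    unfolding sum_distrib_left
    by (intro sum.cong refl) (simp add: diag sym[of "Suc _"] power2_eq_square algebra_simps)
  finally show ?thesis by simp
qed

section \<open>Directions and angles\<close>

(* For edges leaving a vertex at angles \<alpha>, \<beta> in (0, 2 pi) - {pi}: both go up or both go down, and the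
   first is on the left at heights close to the vertex. *)
definition dart_left :: "real \<Rightarrow> real \<Rightarrow> bool" where
  "dart_left \<alpha> \<beta> \<longleftrightarrow> \<alpha> < pi \<and> \<beta> < pi \<and> \<beta> < \<alpha> \<or> pi < \<alpha> \<and> pi < \<beta> \<and> \<alpha> < \<beta>"

lemma Arg2pi_divide_if:
  assumes "u \<noteq> 0" "z \<noteq> 0"
  shows "Arg2pi (z / u) =
    (if Arg2pi u \<le> Arg2pi z then Arg2pi z - Arg2pi u else Arg2pi z - Arg2pi u + 2 * pi)"
  using Arg2pi_diff[of z u] assms by (auto split: if_splits)

text \<open>The factor \<open>w\<close> cancels in the quotient, so the cyclic order around
  \<open>v\<close> can be read off in the rotated plane.\<close>

lemma ccw_angle_eq:
  assumes "w \<noteq> 0" "x \<noteq> v" "y \<noteq> v"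
  shows "ccw_angle v x y =
    (if Arg2pi (w * (x - v)) \<le> Arg2pi (w * (y - v))
     then Arg2pi (w * (y - v)) - Arg2pi (w * (x - v))
     else Arg2pi (w * (y - v)) - Arg2pi (w * (x - v)) + 2 * pi)"
  using Arg2pi_divide_if[of "w * (x - v)" "w * (y - v)"] assms by (simp add: ccw_angle_def)

definition strictly_between :: "real \<Rightarrow> real \<Rightarrow> real \<Rightarrow> bool" where
  "strictly_between \<alpha> \<beta> x \<longleftrightarrow> \<alpha> < x \<and> x < \<beta> \<or> \<beta> < x \<and> x < \<alpha>"

text \<open>Cutting the circle at angle 0 makes the cyclic order linear. The darts to
  \<open>a\<close> and \<open>b\<close> bound two arcs, and crossing means that \<open>c\<close> and
  \<open>d\<close> lie in different ones.\<close>

lemma transitions_cross_iff_between: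
  fixes w v a b c d :: complex
  defines "\<theta> \<equiv> \<lambda>x. Arg2pi (w * (x - v))"
  assumes "w \<noteq> 0" "a \<noteq> v" "b \<noteq> v" "c \<noteq> v" "d \<noteq> v"
    and ne: "\<theta> a \<noteq> \<theta> b" "\<theta> a \<noteq> \<theta> c" "\<theta> a \<noteq> \<theta> d" "\<theta> b \<noteq> \<theta> c" "\<theta> b \<noteq> \<theta> d" "\<theta> c \<noteq> \<theta> d"
  shows "transitions_cross (v, {a, b}) (v, {c, d}) \<longleftrightarrow>
    strictly_between (\<theta> a) (\<theta> b) (\<theta> c) \<noteq> strictly_between (\<theta> a) (\<theta> b) (\<theta> d)"
proof -
  have ccw: "ccw_angle v x y = (if \<theta> x \<le> \<theta> y then \<theta> y - \<theta> x else \<theta> y - \<theta> x + 2 * pi)"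
    if "x \<noteq> v" "y \<noteq> v" for x y
    using ccw_angle_eq[of w x v y] that assms by (simp add: \<theta>_def)
  have b: "0 \<le> \<theta> x" "\<theta> x < 2 * pi" for x
    by (auto simp: \<theta>_def Arg2pi_ge_0 Arg2pi_lt_2pi)
  let ?P = "\<lambda>e1 e2 h1 h2. 0 < ccw_angle v e1 h1 \<and> ccw_angle v e1 h1 < ccw_angle v e1 e2 \<and>
      ccw_angle v e1 e2 < ccw_angle v e1 h2"
  have "transitions_cross (v, {a, b}) (v, {c, d}) \<longleftrightarrow>
      ?P a b c d \<or> ?P a b d c \<or> ?P b a c d \<or> ?P b a d c"
    unfolding transitions_cross_def by (auto simp: doubleton_eq_iff)
  also have "\<dots> \<longleftrightarrow> strictly_between (\<theta> a) (\<theta> b) (\<theta> c) \<noteq> strictly_between (\<theta> a) (\<theta> b) (\<theta> d)"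
  proof -
    \<comment> \<open>For \<open>\<theta> x < \<theta> y\<close> the counterclockwise arc from
      \<open>x\<close> to \<open>y\<close> is the interval between the two angles; otherwise it runs
      through angle 0 and is the complement.\<close>
    have P: "?P x y e f \<longleftrightarrow>
        (if \<theta> x < \<theta> y
         then strictly_between (\<theta> x) (\<theta> y) (\<theta> e) \<and> \<not> strictly_between (\<theta> x) (\<theta> y) (\<theta> f)
         else \<not> strictly_between (\<theta> x) (\<theta> y) (\<theta> e) \<and> strictly_between (\<theta> x) (\<theta> y) (\<theta> f))"
      if "x \<noteq> v" "y \<noteq> v" "e \<noteq> v" "f \<noteq> v" "\<theta> x \<noteq> \<theta> y" "\<theta> x \<noteq> \<theta> e" "\<theta> x \<noteq> \<theta> f"
        "\<theta> y \<noteq> \<theta> e" "\<theta> y \<noteq> \<theta> f" "\<theta> e \<noteq> \<theta> f" for x y e f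
      unfolding ccw[OF that(1,2)] ccw[OF that(1,3)] ccw[OF that(1,4)] strictly_between_def
      using that(5-) b[of x] b[of y] b[of e] b[of f]
      by (cases "\<theta> x < \<theta> y"; cases "\<theta> x < \<theta> e"; cases "\<theta> x < \<theta> f") (simp_all, linarith+)
    have sym: "strictly_between (\<theta> b) (\<theta> a) x = strictly_between (\<theta> a) (\<theta> b) x" for x
      by (auto simp: strictly_between_def)
    show ?thesis
      using assms(3-6) ne ne[symmetric] by (simp add: P sym) argo
  qed
  finally show ?thesis .
qed

text \<open>Modulo 2, \<open>dart_left x y\<close> is \<open>[x < y] + [x < pi]\<close>, also for
  angles on different sides of \<open>pi\<close>. In the sum of four each \<open>[x < pi]\<close>
  occurs twice and cancels; the remaining comparisons say whether the two pairs separate each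
  other.\<close>

lemma strictly_between_sum_dart_left:
  assumes "\<alpha> \<noteq> pi" "\<beta> \<noteq> pi" "\<gamma> \<noteq> pi" "\<delta> \<noteq> pi"
    "\<alpha> \<noteq> \<beta>" "\<alpha> \<noteq> \<gamma>" "\<alpha> \<noteq> \<delta>" "\<beta> \<noteq> \<gamma>" "\<beta> \<noteq> \<delta>" "\<gamma> \<noteq> \<delta>"
  shows "(of_bool (strictly_between \<alpha> \<beta> \<gamma> \<noteq> strictly_between \<alpha> \<beta> \<delta>) :: bit) =
    of_bool (dart_left \<alpha> \<gamma>) + of_bool (dart_left \<alpha> \<delta>) + of_bool (dart_left \<beta> \<gamma>)
      + of_bool (dart_left \<beta> \<delta>)"
proof -
  have *: "(of_bool P :: bit) = of_bool A + of_bool B + of_bool C + of_bool D \<longleftrightarrow>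
      P = (((A \<noteq> B) \<noteq> C) \<noteq> D)" for P A B C D
    by auto
  have 1: "strictly_between \<alpha> \<beta> x = ((\<alpha> < x) \<noteq> (\<beta> < x))" if "\<alpha> \<noteq> x" "\<beta> \<noteq> x" for x
    using that by (auto simp: strictly_between_def)
  have 2: "dart_left x y = ((x < pi) = (y < pi) \<and> ((x < y) \<noteq> (x < pi)))"
    if "x \<noteq> pi" "y \<noteq> pi" "x \<noteq> y" for x y
    using that by (auto simp: dart_left_def)
  show ?thesis
    unfolding * using assms by (simp add: 1 2) argo
qed

text \<open>Up to a positive factor, the sine of the angle difference is the cross product
  \<open>Im u * (Re z - Re u)\<close>. Both angles lie in the same open half circle, so the sign of
  the sine decides their order.\<close>

lemma dart_left_same_height:
  assumes "Im u = Im z" "Im u \<noteq> 0"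
  shows "dart_left (Arg2pi u) (Arg2pi z) \<longleftrightarrow> Re u < Re z"
proof -
  let ?n = "norm u * norm z"
  have n: "?n > 0" using assms by (cases "u = 0"; cases "z = 0") auto
  have b: "0 \<le> Arg2pi x" "Arg2pi x < 2 * pi" for x
    by (auto simp: Arg2pi_ge_0 Arg2pi_lt_2pi)
  have "?n * sin (Arg2pi u - Arg2pi z) = Im u * Re z - Re u * Im z"
    unfolding sin_diff by (simp flip: cos_Arg2pi sin_Arg2pi add: algebra_simps)
  then have s: "?n * sin (Arg2pi u - Arg2pi z) = Im u * (Re z - Re u)"
    using assms by (simp add: algebra_simps)
  show ?thesis
  proof (cases "Im u > 0")
    case True
    then have h: "0 < Arg2pi u" "Arg2pi u < pi" "0 < Arg2pi z" "Arg2pi z < pi"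
      using assms Arg2pi_lt_pi[of u] Arg2pi_lt_pi[of z] by auto
    have "Re u < Re z \<longleftrightarrow> 0 < ?n * sin (Arg2pi u - Arg2pi z)"
      unfolding s using True by (simp add: zero_less_mult_iff)
    also have "\<dots> \<longleftrightarrow> 0 < sin (Arg2pi u - Arg2pi z)"
      using mult_less_cancel_left_pos[OF n, of 0] by (simp only: mult_zero_right)
    also have "\<dots> \<longleftrightarrow> Arg2pi z < Arg2pi u"
      using h sin_gt_zero[of "Arg2pi u - Arg2pi z"] sin_ge_zero[of "Arg2pi z - Arg2pi u"]
      by (smt (verit) sin_minus)
    finally show ?thesis using h by (auto simp: dart_left_def)
  next
    case False
    then have h: "pi < Arg2pi u" "pi < Arg2pi z"
      using assms Arg2pi_le_pi[of u] Arg2pi_le_pi[of z] by auto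
    have "Re u < Re z \<longleftrightarrow> ?n * sin (Arg2pi u - Arg2pi z) < 0"
      unfolding s using False assms by (auto simp add: mult_less_0_iff)
    also have "\<dots> \<longleftrightarrow> sin (Arg2pi u - Arg2pi z) < 0"
      using mult_less_cancel_left_pos[OF n, of _ 0] by (simp only: mult_zero_right)
    also have "\<dots> \<longleftrightarrow> Arg2pi u < Arg2pi z"
      using h b[of u] b[of z] sin_ge_zero[of "Arg2pi u - Arg2pi z"] sin_gt_zero[of "Arg2pi z - Arg2pi u"]
      by (smt (verit) sin_minus)
    finally show ?thesis using h by (auto simp: dart_left_def)
  qed
qed

lemma Arg_eq_Arg2pi:
  assumes "z \<noteq> 0"
  shows "Arg z = (if Arg2pi z \<le> pi then Arg2pi z else Arg2pi z - 2 * pi)"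
proof (rule Arg_unique[of "norm z"])
  show "complex_of_real (cmod z) *
    exp (\<i> * complex_of_real (if Arg2pi z \<le> pi then Arg2pi z else Arg2pi z - 2 * pi)) = z"
  proof -
    have "exp (\<i> * complex_of_real (x - 2 * pi)) = exp (\<i> * complex_of_real x)" for x
      using exp_two_pi_i' by (simp add: right_diff_distrib exp_diff mult.commute[of 2])
    then show ?thesis using Arg2pi_eq[of z] by simp
  qed
qed (use assms Arg2pi_ge_0[of z] Arg2pi_lt_2pi[of z] in auto)

(* Passing from z to z' winds across the positive real axis exactly when the dart -z lies left of z'. *)
lemma Arg_turn:
  assumes "z \<noteq> 0" "z' \<noteq> 0" "Arg2pi z \<noteq> pi" "Arg2pi z' \<noteq> pi" "Arg2pi (- z) \<noteq> Arg2pi z'"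
    "Arg2pi z \<noteq> 0" "Arg2pi z' \<noteq> 0"
  obtains n :: int where "Arg (z' / z) = Arg2pi z' - Arg2pi z + 2 * pi * of_int n"
    "(of_int n :: bit) = of_bool (dart_left (Arg2pi (- z)) (Arg2pi z'))"
proof -
  let ?a = "Arg2pi z" and ?b = "Arg2pi z'"
  \<comment> \<open>\<open>Arg\<close> takes values up to \<open>pi\<close> in size, while a
    difference of two \<open>Arg2pi\<close> values can approach \<open>2 * pi\<close>;
    \<open>n\<close> is the number of full turns by which they differ.\<close>
  define n :: int where "n = (if ?b - ?a > pi then -1 else if ?b - ?a < - pi then 1 else 0)"
  have r: "0 \<le> ?a" "?a < 2 * pi" "0 \<le> ?b" "?b < 2 * pi" 
    by (auto simp: Arg2pi_ge_0 Arg2pi_lt_2pi)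
  have ne: "?b - ?a \<noteq> pi" "?b - ?a \<noteq> - pi"
    using assms r unfolding Arg2pi_minus[OF assms(1)] by (auto split: if_splits)
  have "Arg (z' / z) = ?b - ?a + 2 * pi * of_int n"
    using r ne assms(1,2) unfolding n_def by (auto simp: Arg_eq_Arg2pi Arg2pi_divide_if)
  moreover have "(of_int n :: bit) = of_bool (dart_left (Arg2pi (- z)) ?b)"
    using r ne assms unfolding n_def dart_left_def Arg2pi_minus[OF assms(1)] by auto
  ultimately show ?thesis by (rule that)
qed

section \<open>Plane graphs with vertices of distinct heights\<close>

text \<open>Multiplication by \<open>w\<close> rotates and scales the plane so that no two vertices
  share a height; in particular no edge is horizontal. The sweep runs along
  \<open>Im (w * v)\<close>.\<close>

locale generic_plane_graph =
  fixes V :: "complex set" and E :: "complex set set" and w :: complex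
  assumes graph: "straight_line_plane_graph V E"
    and w_nonzero: "w \<noteq> 0"
    and heights_inj: "inj_on (\<lambda>v. Im (w * v)) V"
begin

definition height :: "complex \<Rightarrow> real" where "height v = Im (w * v)"

definition dart_angle :: "complex \<Rightarrow> complex \<Rightarrow> real" where
  "dart_angle v a = Arg2pi (w * (a - v))"

definition left_dart :: "complex \<Rightarrow> complex \<Rightarrow> complex \<Rightarrow> bool" where
  "left_dart v a b \<longleftrightarrow> dart_left (dart_angle v a) (dart_angle v b)"

definition point_at :: "complex \<Rightarrow> complex \<Rightarrow> real \<Rightarrow> complex" where
  "point_at c d y = c + of_real ((y - height c) / (height d - height c)) * (d - c)"

definition left_of_edge :: "complex \<Rightarrow> complex set \<Rightarrow> bool" where
  "left_of_edge v h \<longleftrightarrow> (\<exists>c d. h = {c, d} \<and> height c < height v \<and> height v < height d \<and>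
     Re (w * v) < Re (w * point_at c d (height v)))"

definition right_of_edge :: "complex \<Rightarrow> complex set \<Rightarrow> bool" where
  "right_of_edge v h \<longleftrightarrow> (\<exists>c d. h = {c, d} \<and> height c < height v \<and> height v < height d \<and>
     Re (w * point_at c d (height v)) < Re (w * v))"

definition left_at :: "complex \<Rightarrow> complex set \<Rightarrow> complex set \<Rightarrow> bool" where
  "left_at v e h \<longleftrightarrow> (\<exists>a b. e = {v, a} \<and> h = {v, b} \<and> left_dart v a b)"

text \<open>The contribution of \<open>v\<close> to the sweep of a pair of edges: whether
  \<open>e\<close> is left of \<open>h\<close> at the height of \<open>v\<close>, an end of at least
  one of them. At a common end the edges meet, so there the comparison is made close to
  \<open>v\<close> instead.\<close>

definition left_event :: "complex \<Rightarrow> complex set \<Rightarrow> complex set \<Rightarrow> bool" where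
  "left_event v e h \<longleftrightarrow>
     (if v \<in> e
      then if v \<in> h then left_at v e h else left_of_edge v h
      else v \<in> h \<and> right_of_edge v e)"

lemma finite_V: "finite V"
  and edge_pair: "e \<in> E \<Longrightarrow> \<exists>a b. e = {a, b} \<and> a \<in> V \<and> b \<in> V \<and> a \<noteq> b"
  and segment_vertices: "{a, b} \<in> E \<Longrightarrow> closed_segment a b \<inter> V = {a, b}"
  and segments_meet: "{a, b} \<in> E \<Longrightarrow> {c, d} \<in> E \<Longrightarrow> {a, b} \<noteq> {c, d} \<Longrightarrow>
    closed_segment a b \<inter> closed_segment c d \<subseteq> {a, b} \<inter> {c, d}"
  using graph unfolding straight_line_plane_graph_def by simp_all (use subsetD in fastforce)

lemma edge_vertices:
  assumes "{a, b} \<in> E"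
  shows "a \<in> V" "b \<in> V" "a \<noteq> b"
proof -
  obtain a' b' where "{a, b} = {a', b'}" "a' \<in> V" "b' \<in> V" "a' \<noteq> b'"
    using edge_pair[OF assms] by blast
  then show "a \<in> V" "b \<in> V" "a \<noteq> b" by (auto simp: doubleton_eq_iff)
qed

lemma height_eq_iff: "a \<in> V \<Longrightarrow> b \<in> V \<Longrightarrow> height a = height b \<longleftrightarrow> a = b"
  using inj_on_eq_iff[OF heights_inj, of a b] by (simp only: height_def)

lemma edge_height_neq: "{a, b} \<in> E \<Longrightarrow> height a \<noteq> height b"
  using edge_vertices[of a b] height_eq_iff[of a b] by blast

lemma edge_obtain:
  assumes "e \<in> E"
  obtains a b where "e = {a, b}" "a \<in> V" "b \<in> V" "height a < height b"
proof -
  obtain a b where e: "e = {a, b}" using edge_pair[OF assms] by blast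
  with assms have "a \<in> V" "b \<in> V" "height a \<noteq> height b"
    using edge_vertices edge_height_neq by blast+
  then consider "height a < height b" | "height b < height a" by linarith
  then show ?thesis
    using e that[of a b] that[of b a] \<open>a \<in> V\<close> \<open>b \<in> V\<close> by (auto simp: insert_commute)
qed

lemma edges_disjoint:
  assumes "{a, b} \<in> E" "{c, d} \<in> E" "{a, b} \<inter> {c, d} = {}"
  shows "closed_segment a b \<inter> closed_segment c d = {}"
  using segments_meet[OF assms(1,2)] edge_vertices[OF assms(1)] assms(3) by auto

text \<open>Two edges leaving \<open>v\<close> in the same direction would overlap, and the nearer
  far end would be a vertex inside the longer segment.\<close>

lemma dart_angle_neq:
  assumes "{v, a} \<in> E" "{v, b} \<in> E" "a \<noteq> b"
  shows "dart_angle v a \<noteq> dart_angle v b"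
proof
  have "v \<noteq> a" "v \<noteq> b" using edge_vertices assms by blast+
  then have ne: "a - v \<noteq> 0" "b - v \<noteq> 0" by auto
  assume "dart_angle v a = dart_angle v b"
  then obtain x where x: "x > 0" "w * (a - v) = of_real x * (w * (b - v))"
    using Arg2pi_eq_iff[of "w * (a - v)" "w * (b - v)"] ne w_nonzero
    by (auto simp: dart_angle_def)
  then have a: "a - v = of_real x * (b - v)" using w_nonzero by simp
  show False
  proof (cases "x \<le> 1")
    case True
    have "a = (1 - x) *\<^sub>R v + x *\<^sub>R b"
      using a by (simp add: scaleR_conv_of_real algebra_simps)
    moreover have "0 \<le> x" using x by simp
    ultimately have "a \<in> closed_segment v b"
      using True unfolding in_segment by blast
    then have "a \<in> {v, b}"
      using segment_vertices[OF assms(2)] edge_vertices[OF assms(1)] by blast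
    then show False using assms ne by auto
  next
    case False
    define r where "r = 1 / x"
    have "b - v = of_real r * (a - v)" using a x by (simp add: r_def)
    then have "b = (1 - r) *\<^sub>R v + r *\<^sub>R a"
      by (simp add: scaleR_conv_of_real algebra_simps)
    moreover have "r \<le> 1" "0 \<le> r" using False by (auto simp: r_def)
    ultimately have "b \<in> closed_segment v a"
      unfolding in_segment by blast
    then have "b \<in> {v, a}"
      using segment_vertices[OF assms(1)] edge_vertices[OF assms(2)] by blast
    then show False using assms ne by auto
  qed
qed

lemma dart_angle_less_pi:
  assumes "{v, a} \<in> E"
  shows "dart_angle v a < pi \<longleftrightarrow> height v < height a" "dart_angle v a \<noteq> pi" "dart_angle v a \<noteq> 0"
proof -
  have "Im (w * (a - v)) = height a - height v" by (simp add: height_def right_diff_distrib)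
  moreover from this have "Im (w * (a - v)) \<noteq> 0" using edge_height_neq[OF assms] by simp
  ultimately show "dart_angle v a < pi \<longleftrightarrow> height v < height a" "dart_angle v a \<noteq> pi"
    "dart_angle v a \<noteq> 0"
    using Arg2pi_le_pi[of "w * (a - v)"] Arg2pi_lt_pi[of "w * (a - v)"]
      Arg2pi_eq_0_pi[of "w * (a - v)"] unfolding dart_angle_def
    by (auto simp: complex_is_Real_iff simp del: times_complex.sel)
qed

section \<open>Horizontal comparison of two edges and cancellation of their events\<close>

lemma point_at_swap:
  assumes "height c \<noteq> height d"
  shows "point_at d c y = point_at c d y"
proof -
  define s where "s = (y - height c) / (height d - height c)"
  have *: "(y - height d) / (height c - height d) = 1 - s"
    using assms by (simp add: s_def field_simps)
  show ?thesis unfolding point_at_def * s_def[symmetric] by (simp add: algebra_simps)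
qed

lemma left_of_edge_iff:
  assumes "height c < height d"
  shows "left_of_edge v {c, d} \<longleftrightarrow> height c < height v \<and> height v < height d \<and>
     Re (w * v) < Re (w * point_at c d (height v))"
  using assms unfolding left_of_edge_def by (auto simp: doubleton_eq_iff)

lemma right_of_edge_iff:
  assumes "height c < height d"
  shows "right_of_edge v {c, d} \<longleftrightarrow> height c < height v \<and> height v < height d \<and>
     Re (w * point_at c d (height v)) < Re (w * v)"
  using assms unfolding right_of_edge_def by (auto simp: doubleton_eq_iff)

lemma height_point_at:
  assumes "height c \<noteq> height d"
  shows "height (point_at c d y) = y"
proof -
  define s where "s = (y - height c) / (height d - height c)"
  have "height (point_at c d y) = height c + s * (height d - height c)"
    unfolding point_at_def s_def[symmetric] by (simp add: height_def algebra_simps)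
  also have "\<dots> = y" using assms by (simp add: s_def)
  finally show ?thesis .
qed

lemma point_at_ends:
  assumes "height c \<noteq> height d"
  shows "point_at c d (height c) = c" "point_at c d (height d) = d"
  using assms by (simp_all add: point_at_def)

lemma point_at_in_segment:
  assumes "height c < height d" "height c \<le> y" "y \<le> height d"
  shows "point_at c d y \<in> closed_segment c d"
proof -
  define s where "s = (y - height c) / (height d - height c)"
  have "0 \<le> s" "s \<le> 1" using assms by (auto simp: s_def)
  moreover have "point_at c d y = (1 - s) *\<^sub>R c + s *\<^sub>R d"
    unfolding point_at_def s_def[symmetric] by (simp add: scaleR_conv_of_real algebra_simps)
  ultimately show ?thesis unfolding in_segment by blast
qed

text \<open>Disjoint segments keep their left-right order on the whole interval of common heights.
  Its two ends are heights of vertices, and the two equal events there cancel.\<close>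

lemma sum_left_event_disjoint:
  assumes "{a, b} \<in> E" "{c, d} \<in> E" "{a, b} \<inter> {c, d} = {}" "height a < height b" "height c < height d"
  shows "(\<Sum>v\<in>V. of_bool (left_event v {a, b} {c, d})) = (0 :: bit)"
proof -
  \<comment> \<open>\<open>D y\<close> is the signed horizontal gap between the two edges at height
    \<open>y\<close>.\<close>
  define D where "D y = Re (w * point_at a b y) - Re (w * point_at c d y)" for y
  have ne: "height a \<noteq> height b" "height c \<noteq> height d" using assms by auto
  have D_nz: "D y \<noteq> 0"
    if "height a \<le> y" "y \<le> height b" "height c \<le> y" "y \<le> height d" for y
  proof
    assume "D y = 0"
    then have "w * point_at a b y = w * point_at c d y"
      using height_point_at[OF ne(1), of y] height_point_at[OF ne(2), of y]
      by (simp add: complex_eq_iff D_def height_def del: times_complex.sel)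
    then have "point_at a b y = point_at c d y" using w_nonzero by simp
    then show False
      using point_at_in_segment[of a b y] point_at_in_segment[of c d y] that assms
        edges_disjoint[OF assms(1-3)] by auto
  qed
  have cont: "continuous_on A D" for A
    unfolding D_def point_at_def by (intro continuous_intros) (use ne in auto)
  \<comment> \<open>A sign change would give a zero of \<open>D\<close> by the intermediate value
    theorem, hence a common point of the segments.\<close>
  have "D y < 0 \<longleftrightarrow> D z < 0"
    if "y \<le> z" "height a \<le> y" "z \<le> height b" "height c \<le> y" "z \<le> height d" for y z
  proof -
    have "\<not> (D y \<le> 0 \<and> 0 \<le> D z)" "\<not> (D z \<le> 0 \<and> 0 \<le> D y)"
      using IVT'[of D y 0 z] IVT2'[of D z 0 y] D_nz that cont by force+
    then show ?thesis by linarith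
  qed
  note sign = this this[symmetric]
  have V: "a \<in> V" "b \<in> V" "c \<in> V" "d \<in> V" using edge_vertices assms by blast+
  have dist: "a \<noteq> b" "a \<noteq> c" "a \<noteq> d" "b \<noteq> c" "b \<noteq> d" "c \<noteq> d" using assms by auto
  then have hne: "height a \<noteq> height c" "height a \<noteq> height d" "height b \<noteq> height c"
    "height b \<noteq> height d"
    using V height_eq_iff by blast+
  have ev: "left_event a {a, b} {c, d} \<longleftrightarrow> height c < height a \<and> height a < height d \<and> D (height a) < 0"
    "left_event b {a, b} {c, d} \<longleftrightarrow> height c < height b \<and> height b < height d \<and> D (height b) < 0"
    "left_event c {a, b} {c, d} \<longleftrightarrow> height a < height c \<and> height c < height b \<and> D (height c) < 0"
    "left_event d {a, b} {c, d} \<longleftrightarrow> height a < height d \<and> height d < height b \<and> D (height d) < 0"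
    using dist unfolding left_event_def left_of_edge_iff[OF assms(5)] right_of_edge_iff[OF assms(4)]
      D_def point_at_ends[OF ne(1)] point_at_ends[OF ne(2)] by auto
  have "(\<Sum>v\<in>V. of_bool (left_event v {a, b} {c, d}) :: bit) =
      (\<Sum>v\<in>{a, b, c, d}. of_bool (left_event v {a, b} {c, d}))"
    using V by (intro sum.mono_neutral_right finite_V) (auto simp: left_event_def)
  also have "\<dots> = of_bool (left_event a {a, b} {c, d}) + of_bool (left_event b {a, b} {c, d})
      + of_bool (left_event c {a, b} {c, d}) + of_bool (left_event d {a, b} {c, d})"
    using dist by (simp add: add.assoc)
  also have "\<dots> = 0"
  proof -
    \<comment> \<open>The height intervals are disjoint (two cases), nested (two cases) or staggered
      (two cases).\<close>
    consider "height b < height c" | "height d < height a"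
      | "height c < height a" "height b < height d"
      | "height a < height c" "height d < height b"
      | "height a < height c" "height c < height b" "height b < height d"
      | "height c < height a" "height a < height d" "height d < height b"
      using hne by linarith
    then show ?thesis
    proof cases
      case 3
      then show ?thesis using assms(4,5) sign(1)[of "height a" "height b"] by (simp add: ev)
    next
      case 4
      then show ?thesis using assms(4,5) sign(1)[of "height c" "height d"] by (simp add: ev)
    next
      case 5
      then show ?thesis using assms(4,5) sign(1)[of "height c" "height b"] by (simp add: ev)
    next
      case 6
      then show ?thesis using assms(4,5) sign(1)[of "height a" "height d"] by (simp add: ev)
    qed (use assms(4,5) in \<open>simp_all add: ev\<close>)
  qed
  finally show ?thesis .
qed

text \<open>Stretching the dart to \<open>d\<close> by a positive factor until it reaches the height
  of \<open>b\<close> keeps its angle, which reduces the claim to vectors of equal height. The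
  stretched dart may end beyond \<open>d\<close>.\<close>

lemma left_dart_iff:
  assumes "height v < height b \<and> height v < height d \<or> height b < height v \<and> height d < height v"
  shows "left_dart v b d \<longleftrightarrow> Re (w * b) < Re (w * point_at v d (height b))"
    "left_dart v d b \<longleftrightarrow> Re (w * point_at v d (height b)) < Re (w * b)"
proof -
  define s where "s = (height b - height v) / (height d - height v)"
  have s: "s > 0" using assms by (auto simp: s_def divide_simps)
  let ?q = "point_at v d (height b)"
  have q: "w * (?q - v) = of_real s * (w * (d - v))"
    unfolding point_at_def s_def[symmetric] by simp
  have "Im (w * (?q - v)) = Im (w * (b - v))" "Im (w * (b - v)) \<noteq> 0"
    using height_point_at[of v d "height b"] assms by (auto simp: height_def right_diff_distrib simp del: times_complex.sel)
  then have "dart_left (Arg2pi (w * (b - v))) (Arg2pi (w * (?q - v))) \<longleftrightarrow>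
      Re (w * (b - v)) < Re (w * (?q - v))"
    "dart_left (Arg2pi (w * (?q - v))) (Arg2pi (w * (b - v))) \<longleftrightarrow>
      Re (w * (?q - v)) < Re (w * (b - v))"
    by (intro dart_left_same_height; simp only:)+
  moreover have "Arg2pi (w * (?q - v)) = dart_angle v d"
    unfolding q dart_angle_def using s by simp
  ultimately show "left_dart v b d \<longleftrightarrow> Re (w * b) < Re (w * point_at v d (height b))"
    "left_dart v d b \<longleftrightarrow> Re (w * point_at v d (height b)) < Re (w * b)"
    by (auto simp: left_dart_def dart_angle_def right_diff_distrib simp del: times_complex.sel)
qed

lemma left_at_iff: "left_at v {v, a} {v, b} \<longleftrightarrow> left_dart v a b"
  by (auto simp: left_at_def doubleton_eq_iff)

text \<open>If both edges leave \<open>v\<close> on the same side, the common heights end at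
  \<open>v\<close> and at whichever of \<open>b\<close>, \<open>d\<close> is nearer in height, with
  the same order at both. If they leave on opposite sides, there is no event.\<close>

lemma sum_left_event_common_vertex:
  assumes E: "{v, b} \<in> E" "{v, d} \<in> E" and "b \<noteq> d"
  shows "(\<Sum>u\<in>V. of_bool (left_event u {v, b} {v, d})) = (0 :: bit)"
proof -
  have V: "v \<in> V" "b \<in> V" "d \<in> V" and ne: "v \<noteq> b" "v \<noteq> d" using edge_vertices assms by blast+
  then have h: "height b \<noteq> height d" "height b \<noteq> height v" "height d \<noteq> height v"
    using height_eq_iff \<open>b \<noteq> d\<close> by blast+
  have "(\<Sum>u\<in>V. of_bool (left_event u {v, b} {v, d}) :: bit) =
      (\<Sum>u\<in>{v, b, d}. of_bool (left_event u {v, b} {v, d}))"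
    using V by (intro sum.mono_neutral_right finite_V) (auto simp: left_event_def)
  also have "\<dots> = of_bool (left_dart v b d) + of_bool (left_event b {v, b} {v, d})
      + of_bool (left_event d {v, b} {v, d})"
    using ne \<open>b \<noteq> d\<close> by (simp add: add.assoc left_event_def left_at_iff)
  also have "left_event b {v, b} {v, d} \<longleftrightarrow> left_of_edge b {v, d}"
    using ne \<open>b \<noteq> d\<close> by (simp add: left_event_def)
  also have "left_event d {v, b} {v, d} \<longleftrightarrow> right_of_edge d {v, b}"
    using ne \<open>b \<noteq> d\<close> by (simp add: left_event_def)
  also have "(of_bool (left_dart v b d) + of_bool (left_of_edge b {v, d})
      + of_bool (right_of_edge d {v, b}) :: bit) = 0"
  proof -
    have opp: "\<not> left_dart v b d" if "height b < height v \<longleftrightarrow> height v < height d"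
      using that h dart_angle_less_pi[OF E(1)] dart_angle_less_pi[OF E(2)]
      by (auto simp: left_dart_def dart_left_def)
    note dl = left_dart_iff(1)[of v b d] left_dart_iff(2)[of v d b]
    have up: "left_of_edge b {v, d} \<longleftrightarrow> height v < height b \<and> height b < height d \<and> left_dart v b d"
      if "height v < height d"
      using that dl(1) by (auto simp: left_of_edge_iff)
    have up': "right_of_edge d {v, b} \<longleftrightarrow> height v < height d \<and> height d < height b \<and> left_dart v b d"
      if "height v < height b"
      using that dl(2) by (auto simp: right_of_edge_iff)
    have dn: "left_of_edge b {v, d} \<longleftrightarrow> height d < height b \<and> height b < height v \<and> left_dart v b d"
      if "height d < height v"
      using that dl(1) point_at_swap[of v d] left_of_edge_iff[of d v b] by (auto simp: insert_commute)
    have dn': "right_of_edge d {v, b} \<longleftrightarrow> height b < height d \<and> height d < height v \<and> left_dart v b d"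
      if "height b < height v"
      using that dl(2) point_at_swap[of v b] right_of_edge_iff[of b v d] by (auto simp: insert_commute)
    consider "height v < height b" "height v < height d" | "height b < height v" "height d < height v"
      | "height v < height b" "height d < height v" | "height b < height v" "height v < height d"
      using h by linarith
    then show ?thesis
    proof cases
      case 1
      then show ?thesis using h up[OF 1(2)] up'[OF 1(1)] by (cases "left_dart v b d") auto
    next
      case 2
      then show ?thesis using h dn[OF 2(2)] dn'[OF 2(1)] by (cases "left_dart v b d") auto
    next
      case 3
      then show ?thesis using dn[OF 3(2)] up'[OF 3(1)] opp by auto
    next
      case 4
      then show ?thesis using up[OF 4(2)] dn'[OF 4(1)] opp by auto
    qed
  qed
  finally show ?thesis .
qed

(* The heights at which both e and h are present form an interval; whether e is left of h is constant
   on it, and the two ends of the interval are the events counted here. *)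
lemma sum_left_event:
  assumes "e \<in> E" "h \<in> E" "e \<noteq> h"
  shows "(\<Sum>v\<in>V. of_bool (left_event v e h)) = (0 :: bit)"
proof -
  obtain a b where e: "e = {a, b}" "height a < height b" using edge_obtain[OF assms(1)] by metis
  obtain c d where h: "h = {c, d}" "height c < height d" using edge_obtain[OF assms(2)] by metis
  show ?thesis
  proof (cases "e \<inter> h = {}")
    case True
    then show ?thesis using sum_left_event_disjoint assms e h by blast
  next
    case False
    then obtain v where "v \<in> e" "v \<in> h" by blast
    then obtain b' d' where "e = {v, b'}" "h = {v, d'}"
      using that[of b d] that[of b c] that[of a d] that[of a c] e h by (auto simp: insert_commute)
    then show ?thesis using sum_left_event_common_vertex assms by metis
  qed
qed

text \<open>The crossing parity becomes a sum of comparisons of single edges, which can be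
  regrouped. Symmetry holds since separation of two pairs of points on a circle is mutual.\<close>

lemma transitions_cross_bit:
  assumes E: "{v, a} \<in> E" "{v, b} \<in> E" "{v, c} \<in> E" "{v, d} \<in> E"
    and ne: "a \<noteq> b" "a \<noteq> c" "a \<noteq> d" "b \<noteq> c" "b \<noteq> d" "c \<noteq> d"
  shows "(of_bool (transitions_cross (v, {a, b}) (v, {c, d})) :: bit) =
    of_bool (left_dart v a c) + of_bool (left_dart v a d) + of_bool (left_dart v b c)
      + of_bool (left_dart v b d)" (is ?bit)
    and "transitions_cross (v, {a, b}) (v, {c, d}) \<longleftrightarrow> transitions_cross (v, {c, d}) (v, {a, b})"
      (is ?sym)
proof -
  have "v \<noteq> a" "v \<noteq> b" "v \<noteq> c" "v \<noteq> d" using E edge_vertices by blast+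
  note vs = this[symmetric]
  note angs = dart_angle_neq[OF E(1,2) ne(1)] dart_angle_neq[OF E(1,3) ne(2)]
    dart_angle_neq[OF E(1,4) ne(3)] dart_angle_neq[OF E(2,3) ne(4)]
    dart_angle_neq[OF E(2,4) ne(5)] dart_angle_neq[OF E(3,4) ne(6)]
  note cross = transitions_cross_iff_between[OF w_nonzero vs angs[unfolded dart_angle_def],
      folded dart_angle_def]
  show ?bit
    unfolding cross left_dart_def
    by (intro strictly_between_sum_dart_left dart_angle_less_pi E angs)
  have "(strictly_between \<alpha> \<beta> \<gamma> \<noteq> strictly_between \<alpha> \<beta> \<delta>) =
      (strictly_between \<gamma> \<delta> \<alpha> \<noteq> strictly_between \<gamma> \<delta> \<beta>)"
    if "\<alpha> \<noteq> \<gamma>" "\<alpha> \<noteq> \<delta>" "\<beta> \<noteq> \<gamma>" "\<beta> \<noteq> \<delta>" for \<alpha> \<beta> \<gamma> \<delta>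
    unfolding strictly_between_def using that by argo
  then show ?sym
    using angs cross transitions_cross_iff_between[OF w_nonzero vs(3,4,1,2), folded dart_angle_def]
    by metis
qed

lemma left_dart_swap:
  assumes "{v, a} \<in> E" "{v, b} \<in> E" "a \<noteq> b"
  shows "left_dart v a b \<longleftrightarrow> (height v < height a \<longleftrightarrow> height v < height b) \<and> \<not> left_dart v b a"
  using dart_angle_neq[OF assms] dart_angle_less_pi[OF assms(1)] dart_angle_less_pi[OF assms(2)]
  by (auto simp: left_dart_def dart_left_def)

end

lemma exists_generic_direction:
  assumes "finite (V :: complex set)"
  obtains w where "w \<noteq> 0" "inj_on (\<lambda>v. Im (w * v)) V"
proof -
  \<comment> \<open>Two vertices with different real parts have equal heights under
    \<open>Complex 1 t\<close> for just one \<open>t\<close>. Pairs with equal real parts only put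
    the harmless quotient 0 into \<open>?B\<close>.\<close>
  let ?B = "(\<lambda>(u, v). - Im (u - v) / Re (u - v)) ` (V \<times> V)"
  have "finite ?B" using assms by simp
  then obtain t where t: "t \<notin> ?B" using ex_new_if_finite[of ?B] infinite_UNIV_char_0 by blast
  have "inj_on (\<lambda>v. Im (Complex 1 t * v)) V"
  proof (rule inj_onI)
    fix u v assume uv: "u \<in> V" "v \<in> V" and eq: "Im (Complex 1 t * u) = Im (Complex 1 t * v)"
    then have *: "Im (u - v) = - t * Re (u - v)" by (simp add: algebra_simps)
    have "t \<noteq> - Im (u - v) / Re (u - v)" using t uv by fastforce
    moreover have "t = - Im (u - v) / Re (u - v)" if "Re (u - v) \<noteq> 0"
      unfolding * using that by (simp del: minus_complex.sel)
    ultimately have "Re (u - v) = 0" by blast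
    then show "u = v" using * by (simp add: complex_eq_iff)
  qed
  then show ?thesis using that[of "Complex 1 t"] by (simp add: complex_eq_iff)
qed

section \<open>Closed trails\<close>

lemma of_nat_bit: "(of_nat n :: bit) = of_bool (odd n)"
  by (induction n) auto

lemma of_int_bit: "(of_int n :: bit) = of_bool (odd n)"
  by (cases n rule: int_cases2) (simp_all add: of_nat_bit)

lemma bit_add_self: "a + a = (0 :: bit)"
  by (cases a) auto

lemma bit_add_one_eq_0: "a + 1 = 0 \<Longrightarrow> a = (1 :: bit)"
  by (cases a) auto

text \<open>A telescoping sum: in characteristic two, plus is minus.\<close>

lemma sum_consecutive_bit:
  fixes a :: "nat \<Rightarrow> bit"
  assumes "m \<le> n"
  shows "(\<Sum>i\<in>{m..<n}. a i + a (Suc i)) = a m + a n"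
  using assms
proof (induction n rule: dec_induct)
  case base
  show ?case by (simp add: bit_add_self)
next
  case (step n)
  then have "(\<Sum>i\<in>{m..<Suc n}. a i + a (Suc i)) = a m + (a n + a n) + a (Suc n)"
    by (simp add: add.assoc)
  then show ?case by (simp only: bit_add_self add_0_right)
qed

lemma sum_rotate3:
  fixes f :: "'i \<Rightarrow> 'j \<Rightarrow> 'v \<Rightarrow> 'a::comm_monoid_add"
  shows "(\<Sum>i\<in>A. \<Sum>j\<in>B i. \<Sum>v\<in>C. f i j v) = (\<Sum>v\<in>C. \<Sum>i\<in>A. \<Sum>j\<in>B i. f i j v)"
proof -
  have "(\<Sum>i\<in>A. \<Sum>j\<in>B i. \<Sum>v\<in>C. f i j v) = (\<Sum>i\<in>A. \<Sum>v\<in>C. \<Sum>j\<in>B i. f i j v)"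
    by (intro sum.cong refl sum.swap)
  also have "\<dots> = (\<Sum>v\<in>C. \<Sum>i\<in>A. \<Sum>j\<in>B i. f i j v)" by (rule sum.swap)
  finally show ?thesis .
qed

lemma sum_triangle_swap:
  fixes f :: "nat \<Rightarrow> nat \<Rightarrow> 'a::comm_monoid_add"
  shows "(\<Sum>j<k. \<Sum>i<j. f i j) = (\<Sum>i<k. \<Sum>j\<in>{Suc i..<k}. f i j)"
proof (induction k)
  case (Suc k)
  have "(\<Sum>i<Suc k. \<Sum>j\<in>{Suc i..<Suc k}. f i j) = (\<Sum>i<k. \<Sum>j\<in>{Suc i..<Suc k}. f i j)" by simp
  also have "\<dots> = (\<Sum>i<k. (\<Sum>j\<in>{Suc i..<k}. f i j) + f i k)"
    by (intro sum.cong) simp_all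
  finally show ?case using Suc by (simp add: sum.distrib)
qed simp

section \<open>Closed trails as periodic sequences, and their darts at a vertex\<close>

definition trail_edge :: "(nat \<Rightarrow> complex) \<Rightarrow> nat \<Rightarrow> complex set" where
  "trail_edge p i = {p i, p (Suc i)}"

definition trail_transition :: "(nat \<Rightarrow> complex) \<Rightarrow> nat \<Rightarrow> complex \<times> complex set" where
  "trail_transition p i = (p (Suc i), {p i, p (Suc (Suc i))})"

text \<open>An infinite periodic sequence needs no index reduction for successors, and choosing
  another starting point is a mere shift.\<close>

definition closed_trail :: "complex set set \<Rightarrow> nat \<Rightarrow> (nat \<Rightarrow> complex) \<Rightarrow> bool" where
  "closed_trail E k p \<longleftrightarrow> k > 0 \<and> (\<forall>i. p (i + k) = p i) \<and> (\<forall>i. trail_edge p i \<in> E) \<and>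
     inj_on (trail_edge p) {..<k}"

lemma closed_trail_shift:
  assumes "closed_trail E k p"
  shows "closed_trail E k (\<lambda>i. p (i + m))"
proof -
  have edge: "trail_edge (\<lambda>i. p (i + m)) = (\<lambda>i. trail_edge p (i + m))"
    by (simp add: trail_edge_def fun_eq_iff)
  have per: "p (i + k) = p i" for i using assms by (simp add: closed_trail_def)
  have per': "trail_edge p (i + k) = trail_edge p i" for i
    using per[of i] per[of "Suc i"] by (simp add: trail_edge_def)
  have "(\<lambda>i. trail_edge p (i + m)) ` {..<k} = trail_edge p ` {..<k}"
    by (rule periodic_image) (use assms per' in \<open>auto simp: closed_trail_def\<close>)
  \<comment> \<open>Injectivity by counting: the shifted map has the same image, of size
    \<open>k\<close>.\<close>
  then have "inj_on (\<lambda>i. trail_edge p (i + m)) {..<k}"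
    using assms by (intro eq_card_imp_inj_on) (auto simp: closed_trail_def card_image)
  moreover have "p (i + k + m) = p (i + m)" for i
    using per[of "i + m"] by (simp add: add.assoc add.commute[of k])
  ultimately show ?thesis
    using assms unfolding closed_trail_def edge by auto
qed

lemma closed_trail_walk_vtx:
  assumes "is_loop E ws"
  shows "closed_trail E (length ws) (walk_vtx ws)"
proof -
  have e: "trail_edge (walk_vtx ws) = walk_edge ws"
    by (simp add: trail_edge_def walk_edge_def fun_eq_iff)
  have per: "walk_vtx ws (i + length ws) = walk_vtx ws i" for i by (simp add: walk_vtx_def)
  have "walk_edge ws (i + length ws) = walk_edge ws i" for i
    using per[of i] per[of "Suc i"] by (simp add: walk_edge_def)
  then have "walk_edge ws i = walk_edge ws (i mod length ws)" for i
    using periodic_mod[of "walk_edge ws" "length ws" i] by metis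
  moreover have "length ws > 0" using assms by (simp add: is_loop_def)
  ultimately have "walk_edge ws i \<in> E" for i
    using assms by (metis is_loop_def mod_less_divisor)
  then show ?thesis using assms per by (auto simp: closed_trail_def e is_loop_def)
qed

lemma trail_transition_walk_vtx:
  "trail_transition (walk_vtx ws) ` {..<length ws} = transitions ws"
  by (simp add: trail_transition_def transitions_def)

locale plane_trail = generic_plane_graph +
  fixes k :: nat and p :: "nat \<Rightarrow> complex"
  assumes trail: "closed_trail E k p"
begin

abbreviation edge :: "nat \<Rightarrow> complex set" where "edge \<equiv> trail_edge p"

lemma length_pos: "k > 0"
  and periodic: "p (i + k) = p i"
  and edge_in: "edge i \<in> E"
  and edge_inj: "inj_on edge {..<k}"
  using trail by (auto simp: closed_trail_def)

lemma periodic': "p k = p 0" "p (Suc k) = p (Suc 0)" "edge (i + k) = edge i" "edge k = edge 0"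
  using periodic[of 0] periodic[of "Suc 0"] periodic[of i] periodic[of "Suc i"]
  by (auto simp: trail_edge_def)

lemma vertex_mod: "p (i mod k) = p i"
  by (rule periodic_mod) (rule periodic)

lemma edge_mod: "edge (i mod k) = edge i"
  by (rule periodic_mod) (rule periodic')

lemma edge_eq_iff: "edge i = edge j \<longleftrightarrow> i mod k = j mod k"
  using edge_inj edge_mod length_pos by (metis inj_onD lessThan_iff mod_less_divisor)

lemma vertex_in: "p i \<in> V"
  using edge_in[of i] edge_vertices unfolding trail_edge_def by blast

lemma consecutive_neq: "p i \<noteq> p (Suc i)" "p (Suc i) \<noteq> p i"
proof -
  show "p i \<noteq> p (Suc i)" using edge_in[of i] edge_vertices unfolding trail_edge_def by blast
  then show "p (Suc i) \<noteq> p i" by (rule not_sym)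
qed

lemma length_gt_1: "k > 1"
  using length_pos consecutive_neq(1)[of 0] periodic[of 0] by (cases "k = 1") auto

lemma Suc_mod_eq_iff: "Suc i mod k = Suc j mod k \<longleftrightarrow> i mod k = j mod k"
proof
  assume "Suc i mod k = Suc j mod k"
  then have "edge (Suc i) = edge (Suc j)" by (simp add: edge_eq_iff)
  have "(Suc i + (k - 1)) mod k = (Suc j + (k - 1)) mod k"
    using \<open>Suc i mod k = Suc j mod k\<close> by (rule mod_add_cong) simp
  then show "i mod k = j mod k" using length_pos by simp
qed (metis mod_Suc_eq)

text \<open>Turning back along the same edge would traverse it twice.\<close>

lemma ends_neq: "p i \<noteq> p (Suc (Suc i))"
proof
  assume "p i = p (Suc (Suc i))"
  then have "edge i = edge (Suc i)" by (auto simp: trail_edge_def)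
  then have "p i = p (Suc i)" using edge_eq_iff vertex_mod by metis
  then show False using consecutive_neq by blast
qed

lemma edge_at: "edge i = {p (Suc i), p i}" "edge (Suc i) = {p (Suc i), p (Suc (Suc i))}"
  by (auto simp: trail_edge_def)

text \<open>Two different passages through a vertex use four different edges. An incoming edge that
  equals an outgoing one would have the same index modulo \<open>k\<close>, so two consecutive
  vertices would coincide.\<close>

lemma darts_distinct:
  assumes "p (Suc i) = p (Suc j)" "i mod k \<noteq> j mod k"
  shows "p i \<noteq> p j" "p i \<noteq> p (Suc (Suc j))" "p (Suc (Suc i)) \<noteq> p j"
    "p (Suc (Suc i)) \<noteq> p (Suc (Suc j))"
proof -
  show "p i \<noteq> p j"
    using assms edge_eq_iff[of i j] by (auto simp: trail_edge_def)
  show "p (Suc (Suc i)) \<noteq> p (Suc (Suc j))"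
    using assms edge_eq_iff[of "Suc i" "Suc j"] Suc_mod_eq_iff by (auto simp: trail_edge_def)
  show "p i \<noteq> p (Suc (Suc j))"
  proof
    assume "p i = p (Suc (Suc j))"
    then have "edge i = edge (Suc j)" using assms by (auto simp: trail_edge_def)
    then have "p i = p (Suc j)" using edge_eq_iff vertex_mod by metis
    then show False using assms consecutive_neq by metis
  qed
  show "p (Suc (Suc i)) \<noteq> p j"
  proof
    assume "p (Suc (Suc i)) = p j"
    then have "edge (Suc i) = edge j" using assms by (auto simp: trail_edge_def)
    then have "p (Suc i) = p j" using edge_eq_iff vertex_mod by metis
    then show False using assms consecutive_neq by metis
  qed
qed

lemma transition_inj: "inj_on (trail_transition p) {..<k}"
proof (rule inj_onI)
  fix i j assume "i \<in> {..<k}" "j \<in> {..<k}" "trail_transition p i = trail_transition p j"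
  then show "i = j" using darts_distinct[of i j]
    by (auto simp: trail_transition_def doubleton_eq_iff)
qed

definition visits :: "complex \<Rightarrow> nat \<Rightarrow> bit" where
  "visits v i = of_bool (p i = v)"

lemma incidence: "(of_bool (v \<in> edge i) :: bit) = visits v i + visits v (Suc i)"
  using consecutive_neq[of i] by (auto simp: visits_def trail_edge_def)

lemma visits_length: "visits v k = visits v 0"
  by (simp add: visits_def periodic')

text \<open>A closed trail has even degree at every vertex.\<close>

lemma sum_incidence: "(\<Sum>i<k. of_bool (v \<in> edge i)) = (0 :: bit)"
  using sum_consecutive_bit[of 0 k "visits v"]
  by (simp add: incidence visits_length bit_add_self atLeast0LessThan)

lemma sum_incidence_mult:
  assumes "F k = F 0"
  shows "(\<Sum>i<k. of_bool (v \<in> edge i) * F i) = (\<Sum>i<k. visits v (Suc i) * (F i + F (Suc i)))"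
  unfolding incidence by (rule sum_edges_eq_sum_transitions[OF visits_length assms])

end

section \<open>Crossings of two edge-disjoint trails\<close>

context generic_plane_graph
begin

lemma cross_transitions_left_at:
  assumes p: "closed_trail E k p" and q: "closed_trail E l q" and v: "p (Suc i) = v" "q (Suc j) = v"
    and ne: "p i \<noteq> q j" "p i \<noteq> q (Suc (Suc j))" "p (Suc (Suc i)) \<noteq> q j"
    "p (Suc (Suc i)) \<noteq> q (Suc (Suc j))"
  shows "(of_bool (transitions_cross (trail_transition p i) (trail_transition q j)) :: bit) =
      of_bool (left_at v (trail_edge p i) (trail_edge q j))
    + of_bool (left_at v (trail_edge p i) (trail_edge q (Suc j)))
    + of_bool (left_at v (trail_edge p (Suc i)) (trail_edge q j))
    + of_bool (left_at v (trail_edge p (Suc i)) (trail_edge q (Suc j)))"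
    and "transitions_cross (trail_transition p i) (trail_transition q j) \<longleftrightarrow>
      transitions_cross (trail_transition q j) (trail_transition p i)"
proof -
  interpret P: plane_trail V E w k p by standard (rule p)
  interpret Q: plane_trail V E w l q by standard (rule q)
  have E: "{v, p i} \<in> E" "{v, p (Suc (Suc i))} \<in> E" "{v, q j} \<in> E" "{v, q (Suc (Suc j))} \<in> E"
    using P.edge_in[of i] P.edge_in[of "Suc i"] Q.edge_in[of j] Q.edge_in[of "Suc j"] v
    by (auto simp: trail_edge_def insert_commute)
  show "(of_bool (transitions_cross (trail_transition p i) (trail_transition q j)) :: bit) =
      of_bool (left_at v (trail_edge p i) (trail_edge q j))
    + of_bool (left_at v (trail_edge p i) (trail_edge q (Suc j)))
    + of_bool (left_at v (trail_edge p (Suc i)) (trail_edge q j))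
    + of_bool (left_at v (trail_edge p (Suc i)) (trail_edge q (Suc j)))"
    unfolding P.edge_at[of i] Q.edge_at[of j] v left_at_iff trail_transition_def
    by (intro transitions_cross_bit(1) E ne P.ends_neq Q.ends_neq)
  show "transitions_cross (trail_transition p i) (trail_transition q j) \<longleftrightarrow>
      transitions_cross (trail_transition q j) (trail_transition p i)"
    unfolding v trail_transition_def
    by (intro transitions_cross_bit(2) E ne P.ends_neq Q.ends_neq)
qed

text \<open>The case distinction written as a polynomial over \<open>bit\<close>, where
  \<open>1 + x\<close> is negation. The last two terms are products of a factor for \<open>e\<close>
  and a factor for \<open>h\<close>, so their double sums can be split.\<close>

lemma left_event_bit:
  "(of_bool (left_event v e h) :: bit) =
     of_bool (v \<in> e) * of_bool (v \<in> h) * of_bool (left_at v e h)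
   + (of_bool (v \<in> e) * ((1 + of_bool (v \<in> h)) * of_bool (left_of_edge v h))
   + (1 + of_bool (v \<in> e)) * of_bool (right_of_edge v e) * of_bool (v \<in> h))"
  by (auto simp: left_event_def)

lemma mutual_crossings:
  assumes p: "closed_trail E k p" and q: "closed_trail E l q"
    and disj: "\<And>i j. trail_edge p i \<noteq> trail_edge q j"
  shows "(\<Sum>i<k. \<Sum>j<l. of_bool (transitions_cross (trail_transition p i) (trail_transition q j)))
    = (0 :: bit)"
proof -
  interpret P: plane_trail V E w k p by standard (rule p)
  interpret Q: plane_trail V E w l q by standard (rule q)
  let ?c = "\<lambda>i j. of_bool (transitions_cross (trail_transition p i) (trail_transition q j)) :: bit"
  have at_vertex: "(\<Sum>i<k. \<Sum>j<l. of_bool (left_event v (P.edge i) (Q.edge j))) =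
      (\<Sum>i<k. \<Sum>j<l. P.visits v (Suc i) * Q.visits v (Suc j) * ?c i j)" for v
  proof -
    let ?x = "\<lambda>i. of_bool (v \<in> P.edge i) :: bit" and ?y = "\<lambda>j. of_bool (v \<in> Q.edge j) :: bit"
    let ?M = "\<lambda>i j. of_bool (left_at v (P.edge i) (Q.edge j)) :: bit"
    have "(\<Sum>i<k. \<Sum>j<l. of_bool (left_event v (P.edge i) (Q.edge j)) :: bit) =
        (\<Sum>i<k. \<Sum>j<l. ?x i * ?y j * ?M i j)
        + ((\<Sum>i<k. \<Sum>j<l. ?x i * ((1 + ?y j) * of_bool (left_of_edge v (Q.edge j))))
        + (\<Sum>i<k. \<Sum>j<l. (1 + ?x i) * of_bool (right_of_edge v (P.edge i)) * ?y j))"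
      unfolding left_event_bit sum.distrib ..
    \<comment> \<open>The double sum factors, and the factor counting incidences of \<open>v\<close>
      with a closed trail is even. The next sum vanishes in the same way.\<close>
    also have "(\<Sum>i<k. \<Sum>j<l. ?x i * ((1 + ?y j) * of_bool (left_of_edge v (Q.edge j)))) = 0"
      unfolding sum_product[symmetric] P.sum_incidence by simp
    also have "(\<Sum>i<k. \<Sum>j<l. (1 + ?x i) * of_bool (right_of_edge v (P.edge i)) * ?y j) = 0"
      unfolding sum_product[symmetric] Q.sum_incidence by simp
    also have "(\<Sum>i<k. \<Sum>j<l. ?x i * ?y j * ?M i j) = (\<Sum>i<k. ?x i * (\<Sum>j<l. ?y j * ?M i j))"
      by (simp only: sum_distrib_left mult.assoc)
    \<comment> \<open>Summation by parts, first in \<open>j\<close> and then in \<open>i\<close>,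
      turns pairs of edges into pairs of transitions.\<close>
    also have "\<dots> = (\<Sum>i<k. ?x i * (\<Sum>j<l. Q.visits v (Suc j) * (?M i j + ?M i (Suc j))))"
      by (subst Q.sum_incidence_mult) (simp_all add: Q.periodic')
    also have "\<dots> = (\<Sum>i<k. P.visits v (Suc i) * ((\<Sum>j<l. Q.visits v (Suc j) * (?M i j + ?M i (Suc j)))
        + (\<Sum>j<l. Q.visits v (Suc j) * (?M (Suc i) j + ?M (Suc i) (Suc j)))))"
      by (subst P.sum_incidence_mult) (simp_all add: P.periodic')
    also have "\<dots> = (\<Sum>i<k. \<Sum>j<l. P.visits v (Suc i) * Q.visits v (Suc j) *
        (?M i j + ?M i (Suc j) + ?M (Suc i) j + ?M (Suc i) (Suc j)))"
      by (simp only: sum_distrib_left algebra_simps sum.distrib)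
    also have "\<dots> = (\<Sum>i<k. \<Sum>j<l. P.visits v (Suc i) * Q.visits v (Suc j) * ?c i j)"
    proof (intro sum.cong refl)
      fix i j
      show "P.visits v (Suc i) * Q.visits v (Suc j) *
          (?M i j + ?M i (Suc j) + ?M (Suc i) j + ?M (Suc i) (Suc j)) =
          P.visits v (Suc i) * Q.visits v (Suc j) * ?c i j"
      proof (cases "p (Suc i) = v \<and> q (Suc j) = v")
        case True
        have "p i \<noteq> q j" "p i \<noteq> q (Suc (Suc j))" "p (Suc (Suc i)) \<noteq> q j"
          "p (Suc (Suc i)) \<noteq> q (Suc (Suc j))"
          using disj[of i j] disj[of i "Suc j"] disj[of "Suc i" j] disj[of "Suc i" "Suc j"] True
          by (auto simp: trail_edge_def)
        then show ?thesis using cross_transitions_left_at(1)[OF p q, of i v j] True by simp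
      qed (auto simp: P.visits_def Q.visits_def)
    qed
    finally show ?thesis by simp
  qed
  have "0 = (\<Sum>i<k. \<Sum>j<l. \<Sum>v\<in>V. of_bool (left_event v (P.edge i) (Q.edge j)) :: bit)"
    using sum_left_event P.edge_in Q.edge_in disj by simp
  also have "\<dots> = (\<Sum>v\<in>V. \<Sum>i<k. \<Sum>j<l. of_bool (left_event v (P.edge i) (Q.edge j)))"
    by (rule sum_rotate3)
  also have "\<dots> = (\<Sum>v\<in>V. \<Sum>i<k. \<Sum>j<l. P.visits v (Suc i) * Q.visits v (Suc j) * ?c i j)"
    by (simp only: at_vertex)
  also have "\<dots> = (\<Sum>i<k. \<Sum>j<l. \<Sum>v\<in>V. P.visits v (Suc i) * Q.visits v (Suc j) * ?c i j)"
    by (rule sum_rotate3[symmetric])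
  also have "\<dots> = (\<Sum>i<k. \<Sum>j<l. ?c i j)"
  proof (intro sum.cong refl)
    fix i j
    have "(\<Sum>v\<in>V. P.visits v (Suc i) * Q.visits v (Suc j) * ?c i j) =
        (\<Sum>v\<in>V. if v = p (Suc i) then of_bool (q (Suc j) = p (Suc i)) * ?c i j else 0)"
      by (intro sum.cong) (auto simp: P.visits_def Q.visits_def)
    also have "\<dots> = of_bool (q (Suc j) = p (Suc i)) * ?c i j"
      using finite_V P.vertex_in by (simp add: sum.delta)
    also have "\<dots> = ?c i j" by (auto simp: transitions_cross_def trail_transition_def)
    finally show "(\<Sum>v\<in>V. P.visits v (Suc i) * Q.visits v (Suc j) * ?c i j) = ?c i j" .
  qed
  finally show ?thesis by simp
qed

end

section \<open>Crossings and turning of a single trail, started at its highest vertex\<close>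

context plane_trail
begin

text \<open>All edges of the trail at its highest vertex go down, so any two of them are comparable
  there.\<close>

lemma left_at_highest_swap:
  assumes top: "\<And>i. height (p i) \<le> height v" and v: "v \<in> edge i" "v \<in> edge j"
    and "edge i \<noteq> edge j"
  shows "left_at v (edge i) (edge j) \<longleftrightarrow> \<not> left_at v (edge j) (edge i)"
proof -
  have *: "\<exists>m. edge i = {v, p m}" if "v \<in> edge i" for i
    using that edge_at(1)[of i] by (auto simp: trail_edge_def)
  obtain m where m: "edge i = {v, p m}" using *[OF v(1)] ..
  obtain n where n: "edge j = {v, p n}" using *[OF v(2)] ..
  note mn = m n
  have E: "{v, p m} \<in> E" "{v, p n} \<in> E" using edge_in mn by metis+
  have "p m \<noteq> p n" using assms mn by auto
  from left_dart_swap[OF E this] show ?thesis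
    unfolding mn left_at_iff using top[of m] top[of n] by auto
qed

lemma no_edge_spans_highest:
  assumes top: "\<And>i. height (p i) \<le> height v"
  shows "\<not> left_of_edge v (edge j)" "\<not> right_of_edge v (edge j)"
  using top[of j] top[of "Suc j"]
  by (auto simp: left_of_edge_def right_of_edge_def trail_edge_def doubleton_eq_iff)

(* Comparing the two edges in the linear order of the trail makes this symmetric and periodic in
   both indices. *)
definition ordered_left :: "complex \<Rightarrow> nat \<Rightarrow> nat \<Rightarrow> bool" where
  "ordered_left v i j \<longleftrightarrow>
     i mod k < j mod k \<and> left_at v (edge i) (edge j) \<or> j mod k < i mod k \<and> left_at v (edge j) (edge i)"

lemma ordered_left_simps:
  "ordered_left v i i = False" "ordered_left v i k = ordered_left v i 0"
  by (auto simp: ordered_left_def periodic')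

lemma ordered_left_commute: "ordered_left v i j = ordered_left v j i"
  by (auto simp: ordered_left_def)

lemma ordered_left_eq: "i < j \<Longrightarrow> j < k \<Longrightarrow> ordered_left v i j = left_at v (edge i) (edge j)"
  by (simp add: ordered_left_def)

text \<open>Index \<open>k\<close> is reduced to 0, so the edges are compared in reverse order; at
  the highest vertex this amounts to negation.\<close>

lemma ordered_left_eq_highest:
  assumes top: "\<And>i. height (p i) \<le> height (p 0)" and "0 < i" "i < k" "p 0 \<in> edge i"
  shows "ordered_left (p 0) i k \<longleftrightarrow> \<not> left_at (p 0) (edge i) (edge k)"
proof -
  have "edge i \<noteq> edge 0" using assms edge_eq_iff[of i 0] by simp
  then show ?thesis
    using left_at_highest_swap[of "p 0" i 0] assms
    by (auto simp: ordered_left_def periodic' trail_edge_def)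
qed

lemma ordered_left_pairs:
  "(\<Sum>j<k. \<Sum>i<j. of_bool (v \<in> edge i) * of_bool (v \<in> edge j) * of_bool (left_at v (edge i) (edge j)))
   = (\<Sum>j<k. \<Sum>i<j. visits v (Suc i) * visits v (Suc j) *
        (of_bool (ordered_left v i j) + of_bool (ordered_left v i (Suc j))
         + of_bool (ordered_left v (Suc i) j) + of_bool (ordered_left v (Suc i) (Suc j))))
     + (\<Sum>i<k. visits v (Suc i) * of_bool (ordered_left v i (Suc i)))"
proof -
  \<comment> \<open>Integer indicators give access to the identity that was proved by halving; the
    result is then reduced modulo 2.\<close>
  let ?a = "\<lambda>i. of_bool (p i = v) :: int" and ?S = "\<lambda>i j. of_bool (ordered_left v i j) :: int"
  have "(of_int ((?a i + ?a (Suc i)) * (?a j + ?a (Suc j)) * ?S i j) :: bit) =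
      of_bool (v \<in> edge i) * of_bool (v \<in> edge j) * of_bool (left_at v (edge i) (edge j))"
    if "i < j" "j < k" for i j
    using that by (simp add: incidence visits_def ordered_left_eq)
  then have "(\<Sum>j<k. \<Sum>i<j. of_bool (v \<in> edge i) * of_bool (v \<in> edge j) *
       of_bool (left_at v (edge i) (edge j)) :: bit) =
      of_int (\<Sum>j<k. \<Sum>i<j. (?a i + ?a (Suc i)) * (?a j + ?a (Suc j)) * ?S i j)"
    unfolding of_int_sum by (intro sum.cong refl) (metis lessThan_iff)
  also have "(\<Sum>j<k. \<Sum>i<j. (?a i + ?a (Suc i)) * (?a j + ?a (Suc j)) * ?S i j) =
      (\<Sum>j<k. \<Sum>i<j. ?a (Suc i) * ?a (Suc j) *
            (?S i j + ?S i (Suc j) + ?S (Suc i) j + ?S (Suc i) (Suc j)))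
         + (\<Sum>i<k. ?a (Suc i) ^ 2 * ?S i (Suc i))"
    by (rule pair_sum_edges_eq_transitions)
      (auto simp: periodic' ordered_left_simps ordered_left_commute)
  also have "(of_int \<dots> :: bit) = (\<Sum>j<k. \<Sum>i<j. visits v (Suc i) * visits v (Suc j) *
        (of_bool (ordered_left v i j) + of_bool (ordered_left v i (Suc j))
         + of_bool (ordered_left v (Suc i) j) + of_bool (ordered_left v (Suc i) (Suc j))))
     + (\<Sum>i<k. visits v (Suc i) * of_bool (ordered_left v i (Suc i)))"
    unfolding of_int_sum of_int_add
    by (intro arg_cong2[of _ _ _ _ "(+)"] sum.cong refl) (simp_all add: visits_def)
  finally show ?thesis .
qed

text \<open>Only \<open>Suc j = k\<close> differs from the plain order of indices. Then
  \<open>v\<close> is the highest vertex, both comparisons with edge \<open>k\<close> are negated,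
  and the two changes cancel.\<close>

lemma cross_eq_ordered_left:
  assumes top: "\<And>i. height (p i) \<le> height (p 0)" and ij: "i < j" "j < k"
    and v: "p (Suc i) = v" "p (Suc j) = v"
  shows "(of_bool (transitions_cross (trail_transition p i) (trail_transition p j)) :: bit) =
    of_bool (ordered_left v i j) + of_bool (ordered_left v i (Suc j))
      + of_bool (ordered_left v (Suc i) j) + of_bool (ordered_left v (Suc i) (Suc j))"
proof -
  have "p (Suc i) = p (Suc j)" "i mod k \<noteq> j mod k" using v ij by auto
  note cross = cross_transitions_left_at(1)[OF trail trail v darts_distinct[OF this]]
  \<comment> \<open>Otherwise two consecutive vertices of the trail would both be
    \<open>v\<close>.\<close>
  have "Suc i \<noteq> j" using v consecutive_neq by metis
  then have lt: "Suc i < j" using ij by simp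
  show ?thesis
  proof (cases "Suc j < k")
    case True
    then show ?thesis using cross lt ij by (simp add: ordered_left_eq)
  next
    case False
    then have j: "Suc j = k" using ij by simp
    then have v0: "v = p 0" using v periodic' by metis
    have "i \<noteq> 0" using v0 v consecutive_neq(2)[of 0] by metis
    moreover have "v \<in> edge i" "v \<in> edge (Suc i)" using v by (auto simp: trail_edge_def)
    ultimately have "ordered_left v i (Suc j) \<longleftrightarrow> \<not> left_at v (edge i) (edge (Suc j))"
      "ordered_left v (Suc i) (Suc j) \<longleftrightarrow> \<not> left_at v (edge (Suc i)) (edge (Suc j))"
      using ordered_left_eq_highest[OF top, of i] ordered_left_eq_highest[OF top, of "Suc i"] lt ij
      unfolding j v0 by auto
    then show ?thesis using cross lt ij by (auto simp: ordered_left_eq)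
  qed
qed

text \<open>Here only one comparison is negated, namely that of the last edge with edge 0. This
  single change is the summand \<open>visits v 0\<close>.\<close>

lemma turn_eq_ordered_left:
  assumes top: "\<And>i. height (p i) \<le> height (p 0)"
  shows "(\<Sum>i<k. visits v (Suc i) * of_bool (ordered_left v i (Suc i))) =
    (\<Sum>i<k. visits v (Suc i) * of_bool (left_dart v (p i) (p (Suc (Suc i))))) + visits v 0"
proof -
  obtain n where k: "k = Suc n" "n > 0" using length_gt_1 by (cases k) auto
  have left: "left_at v (edge i) (edge (Suc i)) \<longleftrightarrow> left_dart v (p i) (p (Suc (Suc i)))"
    if "p (Suc i) = v" for i
    unfolding edge_at[of i] that left_at_iff ..
  have "(\<Sum>i<n. visits v (Suc i) * of_bool (ordered_left v i (Suc i))) =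
    (\<Sum>i<n. visits v (Suc i) * of_bool (left_dart v (p i) (p (Suc (Suc i)))))"
  proof (intro sum.cong refl)
    fix i assume "i \<in> {..<n}"
    then have "ordered_left v i (Suc i) = left_at v (edge i) (edge (Suc i))"
      using k by (intro ordered_left_eq) auto
    then show "visits v (Suc i) * of_bool (ordered_left v i (Suc i)) =
        visits v (Suc i) * of_bool (left_dart v (p i) (p (Suc (Suc i))))"
      using left[of i] by (simp add: visits_def)
  qed
  moreover have "visits v (Suc n) * of_bool (ordered_left v n (Suc n)) =
      visits v (Suc n) * of_bool (left_dart v (p n) (p (Suc (Suc n)))) + visits v 0"
  proof (cases "p (Suc n) = v")
    case True
    then have v: "v = p 0" using periodic' k by simp
    have "p 0 \<in> edge n" using True v by (auto simp: trail_edge_def)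
    then have "ordered_left v n (Suc n) \<longleftrightarrow> \<not> left_dart v (p n) (p (Suc (Suc n)))"
      using ordered_left_eq_highest[OF top, of n] k left[OF True] v by auto
    then show ?thesis using True v by (auto simp: visits_def)
  next
    case False
    then show ?thesis using periodic' k by (simp add: visits_def)
  qed
  ultimately show ?thesis unfolding k by (simp add: add.assoc)
qed

text \<open>An initial piece of the trail up to index \<open>j\<close> has incidence parity
  \<open>visits v 0 + visits v j\<close> at \<open>v\<close>. The second term vanishes for
  \<open>v\<close> off edge \<open>j\<close>; the first would make \<open>v\<close> the highest
  vertex, whose height no edge spans. The final pieces behave likewise.\<close>

lemma sum_outside_edges:
  assumes top: "\<And>i. height (p i) \<le> height (p 0)"
  shows "(\<Sum>j<k. \<Sum>i<j. of_bool (v \<in> edge i) *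
      ((1 + of_bool (v \<in> edge j)) * of_bool (left_of_edge v (edge j)))) = (0 :: bit)"
    and "(\<Sum>j<k. \<Sum>i<j. (1 + of_bool (v \<in> edge i)) * of_bool (right_of_edge v (edge i)) *
      of_bool (v \<in> edge j)) = (0 :: bit)"
proof -
  have off: "v \<notin> edge j \<Longrightarrow> visits v j = 0" "v \<notin> edge j \<Longrightarrow> visits v (Suc j) = 0" for v j
    by (auto simp: visits_def trail_edge_def)
  have high: "of_bool (left_of_edge v (edge j)) * visits v 0 = 0"
    "of_bool (right_of_edge v (edge j)) * visits v 0 = 0" for j
    using no_edge_spans_highest[OF top] by (auto simp: visits_def)
  have "(\<Sum>i<j. of_bool (v \<in> edge i) *
      ((1 + of_bool (v \<in> edge j)) * of_bool (left_of_edge v (edge j)))) = (0 :: bit)" for j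
  proof -
    have "(\<Sum>i<j. of_bool (v \<in> edge i)) = visits v 0 + visits v j"
      using sum_consecutive_bit[of 0 j "visits v"] by (simp add: incidence atLeast0LessThan)
    then show ?thesis
      unfolding sum_distrib_right[symmetric] using high(1)[of j] off(1)[of v j] by auto
  qed
  then show "(\<Sum>j<k. \<Sum>i<j. of_bool (v \<in> edge i) *
      ((1 + of_bool (v \<in> edge j)) * of_bool (left_of_edge v (edge j)))) = (0 :: bit)"
    by (simp only: sum.neutral_const)
  have *: "(\<Sum>j\<in>{Suc i..<k}. (1 + of_bool (v \<in> edge i)) * of_bool (right_of_edge v (edge i)) *
      of_bool (v \<in> edge j)) = (0 :: bit)" if "i < k" for i
  proof -
    have "(\<Sum>j\<in>{Suc i..<k}. of_bool (v \<in> edge j)) = visits v (Suc i) + visits v 0"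
      using sum_consecutive_bit[of "Suc i" k "visits v"] that
      by (simp add: incidence visits_length)
    then show ?thesis
      unfolding sum_distrib_left[symmetric] using high(2)[of i] off(2)[of v i] by auto
  qed
  show "(\<Sum>j<k. \<Sum>i<j. (1 + of_bool (v \<in> edge i)) * of_bool (right_of_edge v (edge i)) *
      of_bool (v \<in> edge j)) = (0 :: bit)"
    \<comment> \<open>The order of summation is exchanged so that the inner sum runs over the final
      piece after edge \<open>i\<close>.\<close>
    unfolding sum_triangle_swap by (rule sum.neutral, rule ballI, rule *) simp
qed

lemma self_crossings:
  assumes top: "\<And>i. height (p i) \<le> height (p 0)"
  shows "(\<Sum>j<k. \<Sum>i<j. of_bool (transitions_cross (trail_transition p i) (trail_transition p j)))
    + (\<Sum>i<k. of_bool (left_dart (p (Suc i)) (p i) (p (Suc (Suc i))))) = (1 :: bit)"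
proof -
  let ?c = "\<lambda>i j. of_bool (transitions_cross (trail_transition p i) (trail_transition p j)) :: bit"
  let ?t = "\<lambda>v i. of_bool (left_dart v (p i) (p (Suc (Suc i)))) :: bit"
  have at_vertex: "(\<Sum>j<k. \<Sum>i<j. of_bool (left_event v (edge i) (edge j))) =
      (\<Sum>j<k. \<Sum>i<j. visits v (Suc i) * visits v (Suc j) * ?c i j)
      + ((\<Sum>i<k. visits v (Suc i) * ?t v i) + visits v 0)" for v
  proof -
    have *: "visits v (Suc i) * visits v (Suc j) *
        (of_bool (ordered_left v i j) + of_bool (ordered_left v i (Suc j))
         + of_bool (ordered_left v (Suc i) j) + of_bool (ordered_left v (Suc i) (Suc j))) =
        visits v (Suc i) * visits v (Suc j) * ?c i j" if "i < j" "j < k" for i j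
      using cross_eq_ordered_left[OF top that, of v] by (auto simp: visits_def)
    have "(\<Sum>j<k. \<Sum>i<j. visits v (Suc i) * visits v (Suc j) *
        (of_bool (ordered_left v i j) + of_bool (ordered_left v i (Suc j))
         + of_bool (ordered_left v (Suc i) j) + of_bool (ordered_left v (Suc i) (Suc j)))) =
       (\<Sum>j<k. \<Sum>i<j. visits v (Suc i) * visits v (Suc j) * ?c i j)"
      by (intro sum.cong refl *) auto
    then show ?thesis
      unfolding left_event_bit sum.distrib sum_outside_edges[OF top] ordered_left_pairs
        turn_eq_ordered_left[OF top]
      by (simp only: add_0_right)
  qed
  have V0: "(\<Sum>v\<in>V. visits v i * F v) = F (p i)" for i F
  proof -
    have "(\<Sum>v\<in>V. visits v i * F v) = (\<Sum>v\<in>V. if v = p i then F v else 0)"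
      by (intro sum.cong) (auto simp: visits_def)
    then show ?thesis using finite_V vertex_in by simp
  qed
  have "0 = (\<Sum>j<k. \<Sum>i<j. \<Sum>v\<in>V. of_bool (left_event v (edge i) (edge j)) :: bit)"
    by (rule sym, intro sum.neutral ballI sum_left_event edge_in) (simp add: edge_eq_iff)
  also have "\<dots> = (\<Sum>v\<in>V. \<Sum>j<k. \<Sum>i<j. of_bool (left_event v (edge i) (edge j)))"
    by (rule sum_rotate3)
  also have "\<dots> = (\<Sum>v\<in>V. \<Sum>j<k. \<Sum>i<j. visits v (Suc i) * visits v (Suc j) * ?c i j)
      + ((\<Sum>v\<in>V. \<Sum>i<k. visits v (Suc i) * ?t v i) + (\<Sum>v\<in>V. visits v 0))"
    by (simp only: at_vertex sum.distrib)
  \<comment> \<open>The starting vertex is counted once: this is the 1 in the result.\<close>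
  also have "(\<Sum>v\<in>V. visits v 0) = 1" using V0[of 0 "\<lambda>_. 1"] by simp
  also have "(\<Sum>v\<in>V. \<Sum>i<k. visits v (Suc i) * ?t v i) = (\<Sum>i<k. ?t (p (Suc i)) i)"
    by (subst sum.swap) (simp only: V0)
  also have "(\<Sum>v\<in>V. \<Sum>j<k. \<Sum>i<j. visits v (Suc i) * visits v (Suc j) * ?c i j) =
      (\<Sum>j<k. \<Sum>i<j. visits (p (Suc i)) (Suc j) * ?c i j)"
    by (subst sum_rotate3[symmetric]) (simp only: V0 mult.assoc)
  also have "\<dots> = (\<Sum>j<k. \<Sum>i<j. ?c i j)"
    by (intro sum.cong refl) (auto simp: visits_def transitions_cross_def trail_transition_def)
  finally have "(\<Sum>j<k. \<Sum>i<j. ?c i j) + (\<Sum>i<k. ?t (p (Suc i)) i) + 1 = 0"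
    by (simp add: add.assoc)
  then show ?thesis by (rule bit_add_one_eq_0)
qed

text \<open>The \<open>Arg2pi\<close> differences telescope to 0 around the trail, so only the full
  turns remain. The factor \<open>w\<close> cancels in the quotients that define the turning
  angles.\<close>

lemma total_turning_bit:
  obtains N :: int where
    "(\<Sum>i<k. Arg ((p (Suc (Suc i)) - p (Suc i)) / (p (Suc i) - p i))) = 2 * pi * of_int N"
    "(of_int N :: bit) = (\<Sum>i<k. of_bool (left_dart (p (Suc i)) (p i) (p (Suc (Suc i)))))"
proof -
  let ?z = "\<lambda>i. w * (p (Suc i) - p i)"
  have "\<exists>n :: int. Arg ((p (Suc (Suc i)) - p (Suc i)) / (p (Suc i) - p i)) =
       Arg2pi (?z (Suc i)) - Arg2pi (?z i) + 2 * pi * of_int n \<and>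
     (of_int n :: bit) = of_bool (left_dart (p (Suc i)) (p i) (p (Suc (Suc i))))" for i
  proof -
    have E: "{p i, p (Suc i)} \<in> E" "{p (Suc i), p (Suc (Suc i))} \<in> E" "{p (Suc i), p i} \<in> E"
      using edge_in[of i] edge_in[of "Suc i"] by (auto simp: trail_edge_def insert_commute)
    have nz: "?z i \<noteq> 0" "?z (Suc i) \<noteq> 0"
      using consecutive_neq(2) w_nonzero by auto
    have m: "- ?z i = w * (p i - p (Suc i))" by (simp add: algebra_simps)
    have q: "?z (Suc i) / ?z i = (p (Suc (Suc i)) - p (Suc i)) / (p (Suc i) - p i)"
      using w_nonzero by simp
    show ?thesis
      using Arg_turn[OF nz] dart_angle_less_pi[OF E(1)] dart_angle_less_pi[OF E(2)]
        dart_angle_neq[OF E(3,2) ends_neq]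
      unfolding left_dart_def dart_angle_def m q by metis
  qed
  then obtain n :: "nat \<Rightarrow> int" where n:
    "\<And>i. Arg ((p (Suc (Suc i)) - p (Suc i)) / (p (Suc i) - p i)) =
       Arg2pi (?z (Suc i)) - Arg2pi (?z i) + 2 * pi * of_int (n i)"
    "\<And>i. (of_int (n i) :: bit) = of_bool (left_dart (p (Suc i)) (p i) (p (Suc (Suc i))))"
    by metis
  have "(\<Sum>i<k. Arg2pi (?z (Suc i)) - Arg2pi (?z i)) = Arg2pi (?z k) - Arg2pi (?z 0)"
    by (rule sum_lessThan_telescope)
  then have "(\<Sum>i<k. Arg ((p (Suc (Suc i)) - p (Suc i)) / (p (Suc i) - p i))) =
      2 * pi * of_int (\<Sum>i<k. n i)"
    unfolding n sum.distrib by (simp add: periodic' sum_distrib_left)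
  then show ?thesis by (rule that) (simp add: n)
qed

end

section \<open>Cardinalities of sets of crossing pairs as double sums\<close>

lemma card_unordered_pairs:
  fixes t :: "nat \<Rightarrow> 'a"
  assumes inj: "inj_on t {..<k}" and sym: "\<And>x y. R x y \<Longrightarrow> R y x"
  shows "of_nat (card {{x, y} | x y. x \<in> t ` {..<k} \<and> y \<in> t ` {..<k} \<and> x \<noteq> y \<and> R x y}) =
    (\<Sum>j<k. \<Sum>i<j. of_bool (R (t i) (t j)) :: 'b::semiring_1)"
proof -
  let ?P = "SIGMA j:{..<k}. {i. i < j \<and> R (t i) (t j)}"
  let ?f = "\<lambda>(j, i). {t i, t j}"
  have "{{x, y} | x y. x \<in> t ` {..<k} \<and> y \<in> t ` {..<k} \<and> x \<noteq> y \<and> R x y} = ?f ` ?P" (is "?A = _")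
  proof
    show "?f ` ?P \<subseteq> ?A"
    proof
      fix s assume "s \<in> ?f ` ?P"
      then obtain i j where s: "s = {t i, t j}" and ij: "i < j" "j < k" "R (t i) (t j)" by auto
      have "t i \<noteq> t j" using inj_on_eq_iff[OF inj, of i j] ij by simp
      then show "s \<in> ?A" using s ij by (intro CollectI exI[of _ "t i"] exI[of _ "t j"]) simp
    qed
    show "?A \<subseteq> ?f ` ?P"
    proof
      fix s assume "s \<in> ?A"
      then obtain i j where s: "s = {t i, t j}" and ij: "i < k" "j < k" "i \<noteq> j" "R (t i) (t j)"
        by blast
      show "s \<in> ?f ` ?P"
      proof (cases "i < j")
        case True
        then have "(j, i) \<in> ?P" using ij by simp
        then show ?thesis unfolding s by (rule rev_image_eqI) simp
      next
        case False
        then have "(i, j) \<in> ?P" using ij sym by simp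
        then show ?thesis unfolding s by (rule rev_image_eqI) (simp add: insert_commute)
      qed
    qed
  qed
  moreover have "inj_on ?f ?P"
    using inj_on_eq_iff[OF inj] by (intro inj_onI) (auto simp: doubleton_eq_iff)
  ultimately have "card ?A = card ?P" by (simp add: card_image)
  also have "\<dots> = (\<Sum>j<k. card {i. i < j \<and> R (t i) (t j)})"
    by (rule card_SigmaI) auto
  finally show ?thesis
    by (simp add: lessThan_def Int_def)
qed

lemma card_related_pairs:
  fixes t s :: "nat \<Rightarrow> 'a"
  assumes "inj_on t {..<k}" "inj_on s {..<l}"
  shows "of_nat (card {(x, y). x \<in> t ` {..<k} \<and> y \<in> s ` {..<l} \<and> R x y}) =
    (\<Sum>i<k. \<Sum>j<l. of_bool (R (t i) (s j)) :: 'b::semiring_1)"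
proof -
  let ?P = "SIGMA i:{..<k}. {j. j < l \<and> R (t i) (s j)}"
  have "{(x, y). x \<in> t ` {..<k} \<and> y \<in> s ` {..<l} \<and> R x y} = map_prod t s ` ?P"
    by auto
  moreover have "inj_on (map_prod t s) ?P"
    using assms by (auto simp: inj_on_def)
  ultimately have "card {(x, y). x \<in> t ` {..<k} \<and> y \<in> s ` {..<l} \<and> R x y} = card ?P"
    by (simp add: card_image)
  also have "\<dots> = (\<Sum>i<k. card {j. j < l \<and> R (t i) (s j)})"
    by (rule card_SigmaI) auto
  finally show ?thesis
    by (simp add: lessThan_def Int_def)
qed

lemma even_iff_bit: "even n \<longleftrightarrow> (of_nat n :: bit) = 0"
  by (simp add: of_nat_bit)

section \<open>Parity of mutual and self-intersection numbers\<close>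

context generic_plane_graph
begin

lemma even_mi:
  assumes "is_loop E ws" "is_loop E ws'" "loop_edges ws \<inter> loop_edges ws' = {}"
  shows "even (mi ws ws')"
proof -
  interpret P: plane_trail V E w "length ws" "walk_vtx ws"
    by standard (rule closed_trail_walk_vtx[OF assms(1)])
  interpret Q: plane_trail V E w "length ws'" "walk_vtx ws'"
    by standard (rule closed_trail_walk_vtx[OF assms(2)])
  have "P.edge i \<in> loop_edges ws" "Q.edge j \<in> loop_edges ws'" for i j
    using P.edge_mod[of i] P.length_pos Q.edge_mod[of j] Q.length_pos
    unfolding loop_edges_def walk_edge_def trail_edge_def
    by (metis (no_types, lifting) imageI lessThan_iff mod_less_divisor)+
  then have "P.edge i \<noteq> Q.edge j" for i j using assms(3) by (metis disjoint_iff)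
  from mutual_crossings[OF P.trail Q.trail this] show ?thesis
    unfolding even_iff_bit mi_def trail_transition_walk_vtx[symmetric]
      card_related_pairs[OF P.transition_inj Q.transition_inj] .
qed

lemma even_si_iff_odd_tau:
  assumes "is_loop E ws"
  shows "even (si ws) \<longleftrightarrow> odd (tau ws)"
proof -
  let ?k = "length ws" and ?q = "walk_vtx ws"
  interpret Q: plane_trail V E w ?k ?q
    by standard (rule closed_trail_walk_vtx[OF assms])
  \<comment> \<open>The index of a highest vertex of the loop; the trail is restarted there.\<close>
  obtain m where m: "\<And>i. i < ?k \<Longrightarrow> height (?q i) \<le> height (?q m)"
  proof -
    let ?H = "(\<lambda>i. height (?q i)) ` {..<?k}"
    have "Max ?H \<in> ?H" using Q.length_pos by (intro Max_in) auto
    then obtain m where "Max ?H = height (?q m)" by auto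
    moreover have "height (?q i) \<le> Max ?H" if "i < ?k" for i using that by (intro Max_ge) auto
    ultimately show ?thesis using that by metis
  qed
  have top: "height (?q i) \<le> height (?q m)" for i
    using m[of "i mod ?k"] Q.length_pos by (simp add: Q.vertex_mod)
  define p where "p i = ?q (i + m)" for i
  interpret P: plane_trail V E w ?k p
    using closed_trail_shift[OF Q.trail, of m] by unfold_locales (simp add: p_def[abs_def])
  have top': "height (p i) \<le> height (p 0)" for i by (simp add: p_def top)
  let ?turn = "\<lambda>q :: nat \<Rightarrow> complex. \<lambda>i. Arg ((q (Suc (Suc i)) - q (Suc i)) / (q (Suc i) - q i))"
  have "trail_transition ?q (i + ?k) = trail_transition ?q i" for i
    using Q.periodic[of i] Q.periodic[of "Suc i"] Q.periodic[of "Suc (Suc i)"]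
    by (simp add: trail_transition_def)
  \<comment> \<open>Restarting the trail changes neither the set of transitions nor, below, the
    total turning.\<close>
  from periodic_image[of "trail_transition ?q", OF this Q.length_pos, of m]
  have trans: "transitions ws = trail_transition p ` {..<?k}"
    by (simp add: trail_transition_walk_vtx[symmetric] trail_transition_def p_def)
  have "?turn ?q (i + ?k) = ?turn ?q i" for i
    using Q.periodic[of i] Q.periodic[of "Suc i"] Q.periodic[of "Suc (Suc i)"] by simp
  from sum_periodic_shift[of "?turn ?q", OF this, of m]
  have turn: "(\<Sum>i<?k. ?turn p i) = (\<Sum>i<?k. turning_angle ws i)"
    by (simp add: p_def turning_angle_def)
  obtain N :: int where N: "(\<Sum>i<?k. ?turn p i) = 2 * pi * of_int N"
    "(of_int N :: bit) = (\<Sum>i<?k. of_bool (left_dart (p (Suc i)) (p i) (p (Suc (Suc i)))))"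
    by (rule P.total_turning_bit)
  have "total_turning ws = of_int N"
    unfolding total_turning_def turn[symmetric] N by simp
  then have "tau ws = nat (N mod 2)" by (simp add: tau_def)
  then have tau: "odd (tau ws) \<longleftrightarrow> (of_int N :: bit) = 1"
    by (cases "even N") (simp_all add: of_int_bit even_nat_iff)
  \<comment> \<open>\<open>card_unordered_pairs\<close> asks for a relation symmetric on its whole
    type, whereas crossing is shown symmetric only for distinct transitions of this trail, hence the
    symmetrized relation.\<close>
  let ?c = "\<lambda>t s. transitions_cross t s \<and> transitions_cross s t"
  have sym: "transitions_cross (trail_transition p i) (trail_transition p j) \<longleftrightarrow>
      ?c (trail_transition p i) (trail_transition p j)" if "i < ?k" "j < ?k" "i \<noteq> j" for i j
  proof (cases "p (Suc i) = p (Suc j)")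
    case True
    have "i mod ?k \<noteq> j mod ?k" using that by simp
    from cross_transitions_left_at(2)[OF P.trail P.trail True refl P.darts_distinct[OF True this]]
    show ?thesis by blast
  next
    case False
    then show ?thesis by (simp add: transitions_cross_def trail_transition_def)
  qed
  have "{{t, s} | t s. t \<in> transitions ws \<and> s \<in> transitions ws \<and> t \<noteq> s \<and> transitions_cross t s} =
      {{t, s} | t s. t \<in> transitions ws \<and> s \<in> transitions ws \<and> t \<noteq> s \<and> ?c t s}"
  proof -
    have "transitions_cross t s \<longleftrightarrow> ?c t s"
      if "t \<in> transitions ws" "s \<in> transitions ws" "t \<noteq> s" for t s
      using that sym unfolding trans by blast
    then show ?thesis by blast
  qed
  then have "(of_nat (si ws) :: bit) =
      (\<Sum>j<?k. \<Sum>i<j. of_bool (?c (trail_transition p i) (trail_transition p j)))"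
    unfolding si_def trans
    by (simp only: card_unordered_pairs[OF P.transition_inj, of ?c, OF conj_commute[THEN iffD1]])
  also have "\<dots> = (\<Sum>j<?k. \<Sum>i<j.
      of_bool (transitions_cross (trail_transition p i) (trail_transition p j)))"
    by (intro sum.cong refl arg_cong[of _ _ of_bool] sym[symmetric]) auto
  finally have "of_nat (si ws) + of_int N = (1 :: bit)"
    using P.self_crossings[OF top'] N by simp
  then show ?thesis
    unfolding tau even_iff_bit[of "si ws"]
    by (cases "of_nat (si ws) :: bit"; cases "of_int N :: bit") simp_all
qed

end

theorem mainTheorem7:
  fixes V :: "complex set" and E :: "complex set set"
    and K :: "complex set \<Rightarrow> 'r::comm_ring_1"
    and Cs :: "complex list list"
  assumes "straight_line_plane_graph V E"
    and "\<forall>j < length Cs. is_loop E (Cs ! j)"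
    and "\<forall>j < length Cs. \<forall>k < length Cs. j \<noteq> k \<longrightarrow>
           loop_edges (Cs ! j) \<inter> loop_edges (Cs ! k) = {}"
  shows "(\<Prod>j<length Cs. (-1) ^ si (Cs ! j))
         * (\<Prod>j<length Cs. \<Prod>k\<in>{j<..<length Cs}. (-1) ^ mi (Cs ! j) (Cs ! k))
         * (\<Prod>e\<in>(\<Union>j<length Cs. loop_edges (Cs ! j)). K e)
       = (\<Prod>j<length Cs. (-1) ^ (tau (Cs ! j) + 1) * (\<Prod>e\<in>loop_edges (Cs ! j). K e))"
proof -
  have "finite V" using assms(1) by (simp add: straight_line_plane_graph_def)
  then obtain w where "w \<noteq> 0" "inj_on (\<lambda>v. Im (w * v)) V"
    by (rule exists_generic_direction)
  then interpret generic_plane_graph V E w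
    using assms(1) by unfold_locales
  have self: "(-1 :: 'r) ^ si (Cs ! j) = (-1) ^ (tau (Cs ! j) + 1)" if "j < length Cs" for j
    using even_si_iff_odd_tau[of "Cs ! j"] assms(2) that by (simp add: minus_one_power_iff)
  have mutual: "(-1 :: 'r) ^ mi (Cs ! j) (Cs ! k) = 1" if "k \<in> {j<..<length Cs}" for j k
    using even_mi[of "Cs ! j" "Cs ! k"] assms(2,3) that by simp
  \<comment> \<open>Edge-disjointness is what splits the product of the weights over the
    loops.\<close>
  have "(\<Prod>e\<in>(\<Union>j<length Cs. loop_edges (Cs ! j)). K e) =
      (\<Prod>j<length Cs. \<Prod>e\<in>loop_edges (Cs ! j). K e)"
    using assms(3) by (intro prod.UNION_disjoint) (auto simp: loop_edges_def)
  then show ?thesis by (simp add: self mutual flip: prod.distrib)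
qed

end
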